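(* Let $n\ge 2$ be an integer, let $m>0$ and $M\ge 0$ be real numbers, and let $\lambda_n=\frac14\sum_{k=1}^{n-1}\csc(k\pi/n)$. Assume that $\lambda_n\neq n q^2+\frac{M}{m}(q^2-1)$ for every positive even integer $q$. Then for every real number $r_0>0$ there exist $b\neq 0$ near $0$, $T_*>0$ near $\frac{\pi}{2}\sqrt{\frac{r_0^3}{nm+M}}$, and $a>0$ near $\sqrt{\frac{\lambda_n m+M}{r_0}}$ (that is, for every $\varepsilon>0$ there exist real numbers $a,b,T_*$ with $a>0$, $T_*>0$, $0<|b|<\varepsilon$, $\left|T_*-\frac{\pi}{2}\sqrt{\frac{r_0^3}{nm+M}}\right|<\varepsilon$ and $\left|a-\sqrt{\frac{\lambda_n m+M}{r_0}}\right|<\varepsilon$) such that the solution $(f,r)$ of the reduced $(n+1)$-body problem with parameters $n,m,M,r_0,a$ and initial conditions $$f(0)=0,\quad \dot f(0)=b,\quad r(0)=r_0,\quad \dot r(0)=0$$ is an odd/even $4T_*$-periodic solution.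
   Context: For an integer $n\ge2$, masses $m>0$, $M\ge0$, and real numbers $r_0>0$, $a\neq 0$, the reduced $(n+1)$-body problem is the following system of ordinary differential equations for real functions $f(t)$ and $r(t)>0$: $$\ddot f=-\frac{(M+mn)f}{h^3},\qquad \ddot r=\frac{r_0^2a^2}{r^3}-\frac{m\lambda_n}{r^2}-\frac{Mr}{h^3},\qquad h=\sqrt{r^2+\Big(\frac{M+nm}{mn}\Big)^2f^2},$$ where $\lambda_n=\frac14\sum_{k=1}^{n-1}\csc(k\pi/n)$. (It describes $n$ bodies of mass $m$ at the vertices of a regular polygon of radius $r$ perpendicular to the $z$-axis, and a body of mass $M$ at height $f$ on the $z$-axis; $r_0a$ is the nonzero angular momentum constant.) A solution $(f,r)$ with $f(0)=0$, $\dot f(0)=b$, $r(0)=r_0$, $\dot r(0)=0$ is called an odd/even $4T_*$-periodic solution ($T_*>0$) if it satisfies $\dot f(T_* )=0$ and $\dot r(T_* )=0$, and $f$ and $r$ are both $4T_*$-periodic functions; in this case $f$ is odd with respect to $t=0$, and both $f$ and $r$ are even with respect to $t=T_*$. *)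

theory Defs
  imports "HOL-Analysis.Analysis"
begin

definition lam :: "nat \<Rightarrow> real" where
  "lam n = (1/4) * (\<Sum>k=1..n-1. 1 / sin (real k * pi / real n))"

definition hdist :: "nat \<Rightarrow> real \<Rightarrow> real \<Rightarrow> real \<Rightarrow> real \<Rightarrow> real" where
  "hdist n m M x y = sqrt (y^2 + ((M + real n * m) / (m * real n))^2 * x^2)"

text \<open>Solutions are twice differentiable and defined for all times; this loses nothing here,
  because the solutions of interest are periodic.\<close>

definition reduced_solution ::
  "nat \<Rightarrow> real \<Rightarrow> real \<Rightarrow> real \<Rightarrow> real \<Rightarrow> (real \<Rightarrow> real) \<Rightarrow> (real \<Rightarrow> real) \<Rightarrow> bool" where
  "reduced_solution n m M r0 a f r \<longleftrightarrow>
     (\<forall>t. 0 < r t \<and>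
          f field_differentiable (at t) \<and>
          r field_differentiable (at t) \<and>
          (deriv f has_real_derivative
             (- ((M + m * real n) * f t) / (hdist n m M (f t) (r t))^3)) (at t) \<and>
          (deriv r has_real_derivative
             (r0^2 * a^2 / (r t)^3 - m * lam n / (r t)^2
                - M * r t / (hdist n m M (f t) (r t))^3)) (at t))"

definition ivp_solution ::
  "nat \<Rightarrow> real \<Rightarrow> real \<Rightarrow> real \<Rightarrow> real \<Rightarrow> real \<Rightarrow> (real \<Rightarrow> real) \<Rightarrow> (real \<Rightarrow> real) \<Rightarrow> bool" where
  "ivp_solution n m M r0 a b f r \<longleftrightarrow>
     reduced_solution n m M r0 a f r \<and>
     f 0 = 0 \<and> deriv f 0 = b \<and> r 0 = r0 \<and> deriv r 0 = 0"

text \<open>Here \<open>4 * T\<close> is a period, not necessarily the least one. Oddness of \<open>f\<close> about \<open>0\<close> and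
  evenness of \<open>f\<close> and \<open>r\<close> about \<open>T\<close> are consequences and not part of the definition.\<close>

definition odd_even_periodic_solution ::
  "nat \<Rightarrow> real \<Rightarrow> real \<Rightarrow> real \<Rightarrow> real \<Rightarrow> real \<Rightarrow> real \<Rightarrow> (real \<Rightarrow> real) \<Rightarrow> (real \<Rightarrow> real) \<Rightarrow> bool" where
  "odd_even_periodic_solution n m M r0 a b T f r \<longleftrightarrow>
     ivp_solution n m M r0 a b f r \<and> T > 0 \<and>
     deriv f T = 0 \<and> deriv r T = 0 \<and>
     (\<forall>t. f (t + 4 * T) = f t) \<and> (\<forall>t. r (t + 4 * T) = r t)"

end

theory Submission
  imports Defs
begin

text \<open>The circular motion \<open>f = 0\<close>, \<open>r = r0\<close> solves the reduced problem when
  \<open>a\<^sup>2 = (lam n * m + M) / r0\<close>. The linearization there decouples: \<open>f\<close> oscillates with frequency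
  \<open>\<omega> = sqrt ((M + m n) / r0\<^sup>3)\<close>, and \<open>r\<close> with frequency \<open>\<nu> = sqrt ((lam n * m + M) / r0\<^sup>3)\<close>
  around an equilibrium that moves with \<open>a\<close>. A quarter period of \<open>f\<close> is \<open>pi / (2 \<omega>)\<close>. The
  excluded values of \<open>lam n\<close> are exactly those with \<open>\<nu> / \<omega>\<close> an even integer, that is, with
  \<open>sin (\<nu> pi / (2 \<omega>)) = 0\<close>.

  Start with \<open>f' = \<epsilon>\<close> and change \<open>a\<^sup>2\<close> by \<open>\<epsilon> \<alpha>\<close>. Up to errors of order \<open>\<epsilon>\<^sup>2\<close> the velocities at time
  \<open>T\<close> are \<open>\<epsilon> cos (\<omega> T)\<close> and \<open>\<epsilon> \<alpha> sin (\<nu> T) / (r0 \<nu>)\<close>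
  (\<open>linear_defect\<close>, \<open>lipschitz_ode_defect\<close>). The first changes sign in \<open>T\<close> and, without
  resonance, the second changes sign in \<open>\<alpha>\<close>, so for small \<open>\<epsilon>\<close> both velocities vanish together for some
  \<open>(T, \<alpha>)\<close>. This step (\<open>quarter_period_orbit\<close>) needs only continuity in \<open>(T, \<alpha>)\<close> and the theorem of
  Poincare and Miranda, instead of derivatives with respect to parameters and the implicit
  function theorem.

  The initial state is invariant under \<open>f \<mapsto> - f\<close> combined with reversal of time, and the state
  at \<open>T\<close> under reversal of time. By uniqueness the solution inherits both symmetries, and their
  composition gives the period \<open>4 T\<close> (\<open>reflected_quarter_orbit_periodic\<close>).

  Existence and uniqueness are obtained for a globally Lipschitz field, in which \<open>r\<close> is replaced
  by \<open>max c r\<close> in the forces. The orbit found satisfies \<open>r \<ge> r0 / 2\<close> at all times, and so solves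
  the original equations.\<close>

section \<open>Differential equations with Lipschitz right-hand side\<close>

text \<open>Gronwall's inequality for a function that starts at zero. In an inner product space the square
  of the norm is differentiable even where \<open>u\<close> vanishes, and
  \<open>2 |u| (L |u| + d) \<le> (2 L + 1) |u|\<^sup>2 + d\<^sup>2\<close> turns the hypothesis into a linear
  differential inequality for it. The crude rate \<open>L + 1\<close> is the price for a bound without
  square roots.\<close>
lemma gronwall_defect:
  fixes u :: "real \<Rightarrow> 'a::real_inner"
  assumes "a \<le> b" "0 \<le> L" "0 \<le> d"
    and der: "\<And>t. a \<le> t \<Longrightarrow> t \<le> b \<Longrightarrow> (u has_vector_derivative u' t) (at t)"
    and bnd: "\<And>t. a \<le> t \<Longrightarrow> t \<le> b \<Longrightarrow> norm (u' t) \<le> L * norm (u t) + d"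
    and "u a = 0"
  shows "norm (u b) \<le> d * exp ((L + 1) * (b - a))"
proof -
  \<comment> \<open>The integrating factor absorbs the linear term; the last summand absorbs what
    remains of \<open>d\<^sup>2\<close> after the factor \<open>E \<le> 1\<close>.\<close>
  define \<psi> where "\<psi> t = (u t \<bullet> u t) * exp (- (2 * L + 1) * (t - a)) - d\<^sup>2 * (t - a)" for t
  have "\<psi> b \<le> \<psi> a"
  proof (rule DERIV_nonpos_imp_nonincreasing[OF \<open>a \<le> b\<close>])
    fix t assume t: "a \<le> t" "t \<le> b"
    define E where "E = exp (- (2 * L + 1) * (t - a))"
    have E: "0 < E" "E \<le> 1"
      using t \<open>0 \<le> L\<close> unfolding E_def by (auto intro!: mult_nonpos_nonneg)
    have "((\<lambda>t. u t \<bullet> u t) has_real_derivative 2 * (u t \<bullet> u' t)) (at t)"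
    proof -
      have "((\<lambda>t. u t \<bullet> u t) has_derivative (\<lambda>h. u t \<bullet> (h *\<^sub>R u' t) + (h *\<^sub>R u' t) \<bullet> u t)) (at t)"
        using der[OF t] unfolding has_vector_derivative_def by (intro has_derivative_inner)
      then show ?thesis
        unfolding has_field_derivative_def
        by (rule has_derivative_eq_rhs) (auto simp: inner_commute)
    qed
    then have "(\<psi> has_real_derivative
       2 * (u t \<bullet> u' t) * E - (2 * L + 1) * (u t \<bullet> u t) * E - d\<^sup>2) (at t)"
      unfolding \<psi>_def E_def by (auto intro!: derivative_eq_intros simp: algebra_simps)
    moreover have "2 * (u t \<bullet> u' t) * E - (2 * L + 1) * (u t \<bullet> u t) * E - d\<^sup>2 \<le> 0"
    proof -
      define s where "s = norm (u t)"
      have "u t \<bullet> u' t \<le> s * norm (u' t)"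
        unfolding s_def by (rule norm_cauchy_schwarz)
      also have "\<dots> \<le> s * (L * s + d)"
        using bnd[OF t] by (intro mult_left_mono) (auto simp: s_def)
      finally have "2 * (u t \<bullet> u' t) \<le> 2 * L * s\<^sup>2 + 2 * s * d"
        by (simp add: power2_eq_square algebra_simps)
      also have "\<dots> \<le> (2 * L + 1) * s\<^sup>2 + d\<^sup>2"
        using sum_squares_bound[of s d] by (simp add: algebra_simps)
      finally have "2 * (u t \<bullet> u' t) - (2 * L + 1) * (u t \<bullet> u t) \<le> d\<^sup>2"
        by (simp add: s_def power2_norm_eq_inner)
      then have "(2 * (u t \<bullet> u' t) - (2 * L + 1) * (u t \<bullet> u t)) * E \<le> d\<^sup>2 * E"
        using E by (intro mult_right_mono) auto
      also have "\<dots> \<le> d\<^sup>2"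
        using E by (simp add: mult_left_le)
      finally show ?thesis by (simp add: algebra_simps)
    qed
    ultimately show "\<exists>y. DERIV \<psi> t :> y \<and> y \<le> 0" by blast
  qed
  then have "(norm (u b))\<^sup>2 * exp (- (2 * L + 1) * (b - a)) \<le> d\<^sup>2 * (b - a)"
    using \<open>u a = 0\<close> by (simp add: \<psi>_def power2_norm_eq_inner)
  then have "(norm (u b))\<^sup>2 \<le> d\<^sup>2 * (b - a) * exp ((2 * L + 1) * (b - a))"
    using pos_divide_le_eq[of "exp ((2 * L + 1) * (b - a))" "(norm (u b))\<^sup>2" "d\<^sup>2 * (b - a)"]
    by (simp only: mult_minus_left exp_minus divide_inverse[symmetric] exp_gt_zero simp_thms)
  also have "\<dots> \<le> d\<^sup>2 * exp (b - a) * exp ((2 * L + 1) * (b - a))"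
    using exp_ge_add_one_self[of "b - a"]
    by (intro mult_right_mono mult_left_mono; (linarith | simp))
  also have "\<dots> = (d * exp ((L + 1) * (b - a)))\<^sup>2"
    by (simp add: power_mult_distrib exp_double[symmetric] exp_add[symmetric] algebra_simps)
  finally show ?thesis
    using \<open>0 \<le> d\<close> by (simp add: abs_le_square_iff[symmetric])
qed

lemma has_vector_derivative_reflect:
  fixes x :: "real \<Rightarrow> 'a::real_normed_vector"
  assumes "(x has_vector_derivative v) (at (c - t))"
  shows "((\<lambda>t. x (c - t)) has_vector_derivative - v) (at t)"
proof -
  have "((\<lambda>t. c - t) has_vector_derivative - 1) (at t)"
    by (auto intro!: derivative_eq_intros)
  from vector_diff_chain_at[OF this assms] show ?thesis
    by (simp add: o_def)
qed

text \<open>The vector field only has to be Lipschitz along the two solutions and the common value may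
  lie anywhere in the time interval; before it, time is reversed.\<close>
lemma lipschitz_ode_unique:
  fixes x y :: "real \<Rightarrow> 'a::real_inner"
  assumes F: "L-lipschitz_on S F"
    and x: "\<And>t. a \<le> t \<Longrightarrow> t \<le> b \<Longrightarrow> x t \<in> S \<and> (x has_vector_derivative F (x t)) (at t)"
    and y: "\<And>t. a \<le> t \<Longrightarrow> t \<le> b \<Longrightarrow> y t \<in> S \<and> (y has_vector_derivative F (y t)) (at t)"
    and t0: "t0 \<in> {a..b}" "x t0 = y t0" and t: "t \<in> {a..b}"
  shows "x t = y t"
proof -
  have L: "0 \<le> L" using F by (rule lipschitz_on_nonneg)
  have lip: "norm (F (x s) - F (y s)) \<le> L * norm (x s - y s)" if "a \<le> s" "s \<le> b" for s
    using lipschitz_onD[OF F, of "x s" "y s"] x[OF that] y[OF that] by (simp add: dist_norm)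
  show ?thesis
  proof (cases "t0 \<le> t")
    case True
    have "norm (x t - y t) \<le> 0 * exp ((L + 1) * (t - t0))"
    proof (rule gronwall_defect[OF True L])
      fix s assume "t0 \<le> s" "s \<le> t"
      then have s: "a \<le> s" "s \<le> b" using t0 t by auto
      show "((\<lambda>s. x s - y s) has_vector_derivative F (x s) - F (y s)) (at s)"
        using x[OF s] y[OF s] by (intro has_vector_derivative_diff) auto
      show "norm (F (x s) - F (y s)) \<le> L * norm (x s - y s) + 0"
        using lip[OF s] by simp
    qed (use t0 in auto)
    then show ?thesis by simp
  next
    case False
    have "norm (x (0 - (- t)) - y (0 - (- t))) \<le> 0 * exp ((L + 1) * (- t - (- t0)))"
    proof (rule gronwall_defect[where u = "\<lambda>s. x (0 - s) - y (0 - s)", OF _ L])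
      fix s assume "- t0 \<le> s" "s \<le> - t"
      then have s: "a \<le> 0 - s" "0 - s \<le> b" using t0 t by auto
      show "((\<lambda>s. x (0 - s) - y (0 - s)) has_vector_derivative
              (- F (x (0 - s))) - (- F (y (0 - s)))) (at s)"
        using x[OF s] y[OF s]
        by (intro has_vector_derivative_diff has_vector_derivative_reflect) auto
      show "norm ((- F (x (0 - s))) - (- F (y (0 - s)))) \<le> L * norm (x (0 - s) - y (0 - s)) + 0"
        using lip[OF s] by (simp add: norm_minus_commute)
    qed (use t0 False in auto)
    then show ?thesis by simp
  qed
qed

lemma global_antiderivative:
  fixes z :: "real \<Rightarrow> 'a::euclidean_space"
  assumes "continuous_on UNIV z"
  shows "\<exists>Z. Z 0 = 0 \<and> (\<forall>t. (Z has_vector_derivative z t) (at t))"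
proof -
  have "isCont z t" for t
    using assms by (simp add: continuous_on_eq_continuous_at)
  then obtain Z where Z: "\<And>t. (Z has_vector_derivative z t) (at t)"
    using einterval_antiderivative[of "-\<infinity>" \<infinity> z] by auto
  have "((\<lambda>t. Z t - Z 0) has_vector_derivative z t) (at t)" for t
    using has_vector_derivative_diff[OF Z[of t] has_vector_derivative_const[of "Z 0"]] by simp
  then show ?thesis by (intro exI[of _ "\<lambda>t. Z t - Z 0"]) auto
qed

text \<open>This estimate makes the Picard operator act on the functions of growth
  \<open>exp (K |t|)\<close>, and contract there: integration gains the factor \<open>1 / K\<close>.\<close>
lemma exponential_growth_antiderivative:
  fixes Z :: "real \<Rightarrow> 'a::real_normed_vector"
  assumes K: "K > 0" and Z0: "Z 0 = 0"
    and Z: "\<And>t. (Z has_vector_derivative z t) (at t)"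
    and z: "\<And>t. norm (z t) \<le> B * exp (K * \<bar>t\<bar>)"
  shows "norm (Z t) \<le> B / K * exp (K * \<bar>t\<bar>)"
proof -
  have B: "0 \<le> B" using order_trans[OF norm_ge_zero z[of 0]] by simp
  have pos: "norm (W t) \<le> B / K * exp (K * t)"
    if t: "0 < t" and W0: "W 0 = 0" and W: "\<And>t. (W has_vector_derivative w t) (at t)"
      and w: "\<And>t. norm (w t) \<le> B * exp (K * \<bar>t\<bar>)" for t and W w :: "real \<Rightarrow> 'a"
  proof -
    have "norm (W t - W 0) \<le> B / K * exp (K * t) - B / K * exp (K * 0)"
    proof (rule differentiable_bound_general[OF t])
      show "continuous_on {0..t} W"
        using W has_vector_derivative_continuous
        by (blast intro: continuous_at_imp_continuous_on)
      show "continuous_on {0..t} (\<lambda>t. B / K * exp (K * t))"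
        by (intro continuous_intros)
      fix s assume "0 < s" "s < t"
      show "(W has_vector_derivative w s) (at s)" by (rule W)
      show "((\<lambda>t. B / K * exp (K * t)) has_vector_derivative B * exp (K * s)) (at s)"
        using K unfolding has_real_derivative_iff_has_vector_derivative[symmetric]
        by (auto intro!: derivative_eq_intros)
      show "norm (w s) \<le> B * exp (K * s)"
        using w[of s] \<open>0 < s\<close> by simp
    qed
    moreover have "0 \<le> B / K" using B K by simp
    ultimately show ?thesis using W0 by simp
  qed
  consider "t = 0" | "0 < t" | "t < 0" by linarith
  then show ?thesis
  proof cases
    case 1 then show ?thesis using B K Z0 by simp
  next
    case 2 then show ?thesis using pos[of t Z z] Z0 Z z by simp
  next
    case 3
    have "norm (Z (0 - (- t))) \<le> B / K * exp (K * (- t))"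
    proof (rule pos[where w = "\<lambda>t. - z (0 - t)"])
      show "((\<lambda>t. Z (0 - t)) has_vector_derivative - z (0 - s)) (at s)" for s
        by (rule has_vector_derivative_reflect[OF Z])
      show "norm (- z (0 - s)) \<le> B * exp (K * \<bar>s\<bar>)" for s
        using z[of "0 - s"] by simp
    qed (use 3 Z0 in auto)
    then show ?thesis using 3 by simp
  qed
qed

text \<open>Global existence, in both time directions at once. Write a candidate solution as
  \<open>exp (K |t|)\<close> times a bounded continuous function \<open>y\<close>. In terms of \<open>y\<close> the Picard operator is a
  contraction of the complete space of bounded continuous functions on the whole line, with
  factor \<open>L / K < 1\<close>. The operator is expressed by an antiderivative vanishing at \<open>0\<close>, so that
  negative times need no separate treatment.\<close>
lemma lipschitz_ode_global_solution:
  fixes F :: "'a::euclidean_space \<Rightarrow> 'a"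
  assumes F: "L-lipschitz_on UNIV F"
  shows "\<exists>x. x 0 = x0 \<and> (\<forall>t. (x has_vector_derivative F (x t)) (at t))"
proof -
  have L: "0 \<le> L" using F by (rule lipschitz_on_nonneg)
  define K where "K = L + 1"
  have K: "K > 0" "L / K < 1" using L by (auto simp: K_def)
  have lip: "norm (F v - F w) \<le> L * norm (v - w)" for v w
    using lipschitz_onD[OF F, of v w] by (simp add: dist_norm)
  define I :: "(real \<Rightarrow> 'a) \<Rightarrow> real \<Rightarrow> 'a" where
    "I z = (SOME Z. Z 0 = 0 \<and> (\<forall>t. (Z has_vector_derivative z t) (at t)))" for z
  define lift where "lift y t = exp (K * \<bar>t\<bar>) *\<^sub>R apply_bcontfun y t" for y :: "real \<Rightarrow>\<^sub>C 'a" and t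
  have cF: "continuous_on UNIV (\<lambda>t. F (lift y t))" for y
    unfolding lift_def
    by (intro continuous_on_compose2[OF lipschitz_on_continuous_on[OF F]] continuous_intros) auto
  have I: "I (\<lambda>t. F (lift y t)) 0 = 0"
      "(I (\<lambda>t. F (lift y t)) has_vector_derivative F (lift y t)) (at t)" for y t
    using someI_ex[OF global_antiderivative[OF cF[of y]]] unfolding I_def by auto
  define P where "P y t = exp (- K * \<bar>t\<bar>) *\<^sub>R (x0 + I (\<lambda>t. F (lift y t)) t)" for y t
  have P: "P y \<in> bcontfun" for y
  proof (rule bcontfun_normI)
    have "continuous_on UNIV (I (\<lambda>t. F (lift y t)))"
      using I(2)[of y] has_vector_derivative_continuous
      by (blast intro: continuous_at_imp_continuous_on)
    then show "continuous_on UNIV (P y)"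
      unfolding P_def by (intro continuous_intros)
    fix t
    define B where "B = norm (F 0) + L * norm y"
    have "norm (F (lift y s)) \<le> B * exp (K * \<bar>s\<bar>)" for s
    proof -
      have "norm (F (lift y s)) \<le> norm (F 0) + L * norm (lift y s)"
        using lip[of "lift y s" 0] norm_triangle_sub[of "F (lift y s)" "F 0"] by simp
      also have "norm (lift y s) \<le> exp (K * \<bar>s\<bar>) * norm y"
        unfolding lift_def using norm_bounded[of y s] by simp
      also have "norm (F 0) + L * (exp (K * \<bar>s\<bar>) * norm y) \<le> B * exp (K * \<bar>s\<bar>)"
        using K mult_left_mono[of 1 "exp (K * \<bar>s\<bar>)" "norm (F 0)"]
        by (simp add: B_def algebra_simps)
      finally show ?thesis using L by (simp add: mult_left_mono)
    qed
    from exponential_growth_antiderivative[OF K(1) I this]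
    have 1: "norm (I (\<lambda>t. F (lift y t)) t) \<le> B / K * exp (K * \<bar>t\<bar>)" .
    have "norm (P y t) \<le> exp (- K * \<bar>t\<bar>) * (norm x0 + B / K * exp (K * \<bar>t\<bar>))"
      unfolding P_def using 1 norm_triangle_ineq[of x0 "I (\<lambda>t. F (lift y t)) t"]
      by (simp del: mult_minus_left)
    also have "\<dots> \<le> norm x0 + B / K"
    proof -
      have "exp (- K * \<bar>t\<bar>) * norm x0 \<le> 1 * norm x0"
        using K by (intro mult_right_mono) auto
      moreover have "exp (- K * \<bar>t\<bar>) * (B / K * exp (K * \<bar>t\<bar>)) = B / K"
        by (simp add: exp_minus)
      ultimately show ?thesis by (simp only: distrib_left)
    qed
    finally show "norm (P y t) \<le> norm x0 + B / K" .
  qed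
  have "\<exists>!y. Bcontfun (P y) = y"
  proof (rule banach_fix_type)
    show "0 \<le> L / K" "L / K < 1" using L K by auto
    show "\<forall>y w. dist (Bcontfun (P y)) (Bcontfun (P w)) \<le> L / K * dist y w"
    proof (intro allI dist_bound)
      fix y w t
      let ?D = "\<lambda>t. I (\<lambda>t. F (lift y t)) t - I (\<lambda>t. F (lift w t)) t"
      have "norm (F (lift y s) - F (lift w s)) \<le> (L * dist y w) * exp (K * \<bar>s\<bar>)" for s
      proof -
        have "lift y s - lift w s = exp (K * \<bar>s\<bar>) *\<^sub>R (apply_bcontfun y s - apply_bcontfun w s)"
          by (simp add: lift_def scaleR_diff_right)
        then have "norm (lift y s - lift w s) = exp (K * \<bar>s\<bar>) * dist (apply_bcontfun y s) (apply_bcontfun w s)"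
          by (simp only: norm_scaleR dist_norm abs_exp_cancel)
        also have "\<dots> \<le> dist y w * exp (K * \<bar>s\<bar>)"
          using mult_right_mono[OF dist_bounded[of y s w], of "exp (K * \<bar>s\<bar>)"]
          by (simp only: mult.commute exp_ge_zero simp_thms)
        finally have "norm (lift y s - lift w s) \<le> dist y w * exp (K * \<bar>s\<bar>)" .
        then have "L * norm (lift y s - lift w s) \<le> L * (dist y w * exp (K * \<bar>s\<bar>))"
          using L by (rule mult_left_mono)
        with lip[of "lift y s" "lift w s"] show ?thesis
          by (simp only: mult.assoc)
      qed
      then have "norm (?D t) \<le> (L * dist y w) / K * exp (K * \<bar>t\<bar>)"
        by (intro exponential_growth_antiderivative[OF K(1)])
           (auto intro!: has_vector_derivative_diff simp: I)
      then have "exp (- K * \<bar>t\<bar>) * norm (?D t)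
          \<le> exp (- K * \<bar>t\<bar>) * ((L * dist y w) / K * exp (K * \<bar>t\<bar>))"
        by (rule mult_left_mono) simp
      also have "\<dots> = L / K * dist y w"
        by (simp add: exp_minus)
      finally have "exp (- K * \<bar>t\<bar>) * norm (?D t) \<le> L / K * dist y w" .
      moreover have "P y t - P w t = exp (- K * \<bar>t\<bar>) *\<^sub>R ?D t"
        by (simp add: P_def scaleR_diff_right[symmetric])
      ultimately show "dist (apply_bcontfun (Bcontfun (P y)) t) (apply_bcontfun (Bcontfun (P w)) t)
                       \<le> L / K * dist y w"
        by (simp add: Bcontfun_inverse[OF P] dist_norm)
    qed
  qed
  then obtain y where "Bcontfun (P y) = y" by blast
  then have y: "apply_bcontfun y t = P y t" for t
    using Bcontfun_inverse[OF P[of y]] by metis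
  have fix_y: "lift y t = x0 + I (\<lambda>t. F (lift y t)) t" for t
  proof -
    have "lift y t = exp (K * \<bar>t\<bar>) *\<^sub>R P y t"
      unfolding lift_def y ..
    also have "\<dots> = x0 + I (\<lambda>t. F (lift y t)) t"
      by (simp add: P_def exp_minus)
    finally show ?thesis .
  qed
  have "(lift y has_vector_derivative F (lift y t)) (at t)" for t
  proof -
    have "((\<lambda>t. x0 + I (\<lambda>t. F (lift y t)) t) has_vector_derivative 0 + F (lift y t)) (at t)"
      by (intro has_vector_derivative_add has_vector_derivative_const I)
    moreover have "lift y = (\<lambda>t. x0 + I (\<lambda>t. F (lift y t)) t)"
      using fix_y by blast
    ultimately show ?thesis by simp
  qed
  moreover have "lift y 0 = x0"
    by (subst fix_y) (simp add: I)
  ultimately show ?thesis by blast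
qed

text \<open>An approximate solution with defect at most \<open>d\<close> stays within a multiple of \<open>d\<close> of the true
  one. This serves twice below: with the linearized motion as approximation, and
  with the solution for a nearby parameter.\<close>
lemma lipschitz_ode_defect:
  fixes x y :: "real \<Rightarrow> 'a::real_inner"
  assumes "a \<le> b" "0 \<le> d" and F: "L-lipschitz_on UNIV F"
    and x: "\<And>t. (x has_vector_derivative F (x t)) (at t)"
    and y: "\<And>t. (y has_vector_derivative y' t) (at t)"
    and defect: "\<And>t. a \<le> t \<Longrightarrow> t \<le> b \<Longrightarrow> norm (F (y t) - y' t) \<le> d"
    and "x a = y a"
  shows "norm (x b - y b) \<le> d * exp ((L + 1) * (b - a))"
proof (rule gronwall_defect[OF \<open>a \<le> b\<close> lipschitz_on_nonneg[OF F] \<open>0 \<le> d\<close>])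
  fix t assume t: "a \<le> t" "t \<le> b"
  show "((\<lambda>t. x t - y t) has_vector_derivative F (x t) - y' t) (at t)"
    by (intro has_vector_derivative_diff x y)
  have "norm (F (x t) - y' t) \<le> norm (F (x t) - F (y t)) + norm (F (y t) - y' t)"
    using norm_triangle_ineq[of "F (x t) - F (y t)" "F (y t) - y' t"] by simp
  also have "\<dots> \<le> L * norm (x t - y t) + d"
    using lipschitz_onD[OF F, of "x t" "y t"] defect[OF t] by (simp add: dist_norm)
  finally show "norm (F (x t) - y' t) \<le> L * norm (x t - y t) + d" .
qed (use \<open>x a = y a\<close> in simp)


text \<open>If \<open>S\<close> reverses the vector field, it maps a solution run backwards to a solution. A solution
  that passes through a fixed point of \<open>S\<close> at time \<open>c\<close> is therefore symmetric about \<open>c\<close>.\<close>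
lemma reversible_ode_symmetric:
  fixes z :: "real \<Rightarrow> 'a::real_inner"
  assumes F: "L-lipschitz_on UNIV F" and S: "bounded_linear S"
    and rev: "\<And>w. F (S w) = - S (F w)"
    and z: "\<And>t. (z has_vector_derivative F (z t)) (at t)"
    and fixed: "S (z c) = z c"
  shows "S (z (2 * c - t)) = z t"
proof (rule lipschitz_ode_unique[OF F, where a = "min c t" and b = "max c t" and ?t0.0 = c])
  fix s
  have "((\<lambda>s. z (2 * c - s)) has_vector_derivative - F (z (2 * c - s))) (at s)"
    by (rule has_vector_derivative_reflect[OF z])
  from bounded_linear.has_vector_derivative[OF S this]
  show "S (z (2 * c - s)) \<in> UNIV \<and>
      ((\<lambda>s. S (z (2 * c - s))) has_vector_derivative F (S (z (2 * c - s)))) (at s)"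
    by (simp add: rev linear_neg[OF bounded_linear.linear[OF S]])
qed (use z fixed in auto)


section \<open>Simultaneous zeros of two functions on a rectangle\<close>

text \<open>The Poincare-Miranda theorem in the plane. Follow the displacement \<open>(u, v)\<close> and push the result
  back into the rectangle; Brouwer gives a fixed point. A fixed point with nonzero \<open>u\<close> or \<open>v\<close>
  would lie on a side across which the displacement points outwards, but the signs make it
  point inwards.\<close>
lemma poincare_miranda_rectangle:
  fixes u v :: "real \<times> real \<Rightarrow> real"
  assumes "a \<le> b" "c \<le> d"
    and u: "continuous_on ({a..b} \<times> {c..d}) u" and v: "continuous_on ({a..b} \<times> {c..d}) v"
    and ua: "\<And>y. y \<in> {c..d} \<Longrightarrow> u (a, y) > 0" and ub: "\<And>y. y \<in> {c..d} \<Longrightarrow> u (b, y) < 0"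
    and vc: "\<And>x. x \<in> {a..b} \<Longrightarrow> v (x, c) > 0" and vd: "\<And>x. x \<in> {a..b} \<Longrightarrow> v (x, d) < 0"
  shows "\<exists>x\<in>{a..b}. \<exists>y\<in>{c..d}. u (x, y) = 0 \<and> v (x, y) = 0"
proof -
  let ?S = "{a..b} \<times> {c..d}"
  define \<phi> where "\<phi> z = (max a (min b (fst z + u z)), max c (min d (snd z + v z)))" for z
  have "compact ?S" "convex ?S" "?S \<noteq> {}"
    using assms(1,2) by (auto intro: compact_Times convex_Times)
  moreover have "continuous_on ?S \<phi>"
    unfolding \<phi>_def by (intro continuous_intros u v)
  moreover have "\<phi> \<in> ?S \<rightarrow> ?S"
    using assms(1,2) by (auto simp: \<phi>_def)
  ultimately obtain z where z: "z \<in> ?S" "\<phi> z = z" by (rule brouwer)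
  obtain x y where [simp]: "z = (x, y)" by (cases z)
  have xy: "x \<in> {a..b}" "y \<in> {c..d}" using z by auto
  have "max a (min b (x + u (x, y))) = x" "max c (min d (y + v (x, y))) = y"
    using z(2) by (simp_all add: \<phi>_def)
  moreover have "x = a \<Longrightarrow> u (x, y) > 0" "x = b \<Longrightarrow> u (x, y) < 0"
      "y = c \<Longrightarrow> v (x, y) > 0" "y = d \<Longrightarrow> v (x, y) < 0"
    using ua ub vc vd xy by auto
  ultimately have "u (x, y) = 0 \<and> v (x, y) = 0"
    using xy by (smt (verit) atLeastAtMost_iff)
  with xy show ?thesis by blast
qed

section \<open>The equations of motion as a vector field\<close>

lemma inverse_cube_diff:
  fixes a b :: real
  assumes "a > 0" "b > 0"
  shows "1 / a^3 - 1 / b^3 = (b - a) * (1 / (a * b^3) + 1 / (a^2 * b^2) + 1 / (a^3 * b))"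
  using assms by (simp add: field_simps power3_eq_cube power2_eq_square)

text \<open>Each force term is a quotient \<open>u / h ^ 3\<close> whose numerator is bounded by a multiple of \<open>h\<close>; this
  bound compensates for \<open>u\<close> being unbounded.\<close>
lemma divide_cube_lipschitz:
  fixes u v h k c :: real
  assumes c: "c > 0" "c \<le> h" "c \<le> k" and u: "\<bar>u\<bar> \<le> C * h"
  shows "\<bar>u / h^3 - v / k^3\<bar> \<le> \<bar>u - v\<bar> / c^3 + 3 * C / c^3 * \<bar>h - k\<bar>"
proof -
  have hk: "h > 0" "k > 0" using c by auto
  have C: "0 \<le> C" using order_trans[OF abs_ge_zero u] hk by (simp add: zero_le_mult_iff)
  have "u / h^3 - v / k^3 = (u - v) / k^3 + u * (1 / h^3 - 1 / k^3)"
    by (simp add: algebra_simps diff_divide_distrib)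
  also have "\<bar>\<dots>\<bar> \<le> \<bar>u - v\<bar> / k^3 + \<bar>u\<bar> * \<bar>1 / h^3 - 1 / k^3\<bar>"
    using hk abs_triangle_ineq[of "(u - v) / k^3" "u * (1 / h^3 - 1 / k^3)"]
    by (simp add: abs_mult)
  also have "\<bar>u - v\<bar> / k^3 \<le> \<bar>u - v\<bar> / c^3"
    using c hk by (intro divide_left_mono power_mono mult_pos_pos) auto
  also have "\<bar>u\<bar> * \<bar>1 / h^3 - 1 / k^3\<bar> \<le> 3 * C / c^3 * \<bar>h - k\<bar>"
  proof -
    have "\<bar>u\<bar> * \<bar>1 / h^3 - 1 / k^3\<bar> \<le> (C * h) * \<bar>1 / h^3 - 1 / k^3\<bar>"
      using u by (intro mult_right_mono) auto
    also have "\<dots> = C * \<bar>h - k\<bar> * (1 / (k * k * k) + 1 / (h * k * k) + 1 / (h * h * k))"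
    proof -
      have "\<bar>1 / h^3 - 1 / k^3\<bar> = \<bar>h - k\<bar> * (1 / (h * k^3) + 1 / (h^2 * k^2) + 1 / (h^3 * k))"
        unfolding inverse_cube_diff[OF hk] using hk by (simp add: abs_mult abs_minus_commute)
      then show ?thesis
        using hk by (simp add: field_simps power3_eq_cube power2_eq_square)
    qed
    also have "\<dots> \<le> C * \<bar>h - k\<bar> * (1 / (c * c * c) + 1 / (c * c * c) + 1 / (c * c * c))"
      using c hk C by (intro mult_left_mono add_mono divide_left_mono mult_mono mult_pos_pos) auto
    finally show ?thesis by (simp add: power3_eq_cube mult_ac)
  qed
  finally show ?thesis by simp
qed

lemma inverse_cube_lipschitz:
  fixes a b c :: real
  assumes c: "c > 0" "c \<le> a" "c \<le> b"
  shows "\<bar>1 / a^3 - 1 / b^3\<bar> \<le> 3 / c^4 * \<bar>a - b\<bar>"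
proof -
  have "\<bar>1 / a^3 - 1 / b^3\<bar> \<le> \<bar>1 - 1\<bar> / c^3 + 3 * (1 / c) / c^3 * \<bar>a - b\<bar>"
    using c by (intro divide_cube_lipschitz) (auto simp: field_simps)
  then show ?thesis by (simp add: power4_eq_xxxx power3_eq_cube)
qed

definition axis_dist :: "real \<Rightarrow> real \<Rightarrow> real \<Rightarrow> real" where
  "axis_dist \<kappa> x r = sqrt (r\<^sup>2 + (\<kappa> * x)\<^sup>2)"

lemma axis_dist_lipschitz:
  assumes "\<kappa> > 0"
  shows "\<bar>axis_dist \<kappa> x r - axis_dist \<kappa> y s\<bar> \<le> \<bar>r - s\<bar> + \<kappa> * \<bar>x - y\<bar>"
proof -
  have "axis_dist \<kappa> x r = norm (r, \<kappa> * x)" for x r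
    by (simp add: axis_dist_def norm_Pair)
  then have "\<bar>axis_dist \<kappa> x r - axis_dist \<kappa> y s\<bar> \<le> norm ((r, \<kappa> * x) - (s, \<kappa> * y))"
    by (simp only: norm_triangle_ineq3)
  also have "\<dots> \<le> \<bar>r - s\<bar> + \<bar>\<kappa> * x - \<kappa> * y\<bar>"
    using norm_Pair_le[of "r - s" "\<kappa> * x - \<kappa> * y"] by simp
  finally show ?thesis
    using assms by (simp add: right_diff_distrib[symmetric] abs_mult)
qed

lemma axis_dist_ge:
  assumes "r \<ge> 0" shows "r \<le> axis_dist \<kappa> x r" "\<bar>\<kappa> * x\<bar> \<le> axis_dist \<kappa> x r"
  using assms by (auto simp: axis_dist_def intro!: real_le_rsqrt)

text \<open>The state is \<open>(f, f', r, r')\<close>, and \<open>P\<close> stands for \<open>r0\<^sup>2 a\<^sup>2\<close>. Replacing \<open>r\<close> by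
  \<open>max c r\<close> removes the collision singularity and makes the field globally Lipschitz; wherever
  \<open>r \<ge> c\<close> it is the field of the original problem.\<close>
definition axis_field ::
  "real \<Rightarrow> real \<Rightarrow> real \<Rightarrow> real \<Rightarrow> real \<Rightarrow> real \<Rightarrow> real \<times> real \<times> real \<times> real \<Rightarrow> real \<times> real \<times> real \<times> real"
  where
  "axis_field \<kappa> G \<Lambda> M c P = (\<lambda>(x, p, r, q).
     let R = max c r; h = axis_dist \<kappa> x R
     in (p, - (G * x / h^3), q, P / R^3 - \<Lambda> / R\<^sup>2 - M * R / h^3))"

text \<open>The constant is uniform in \<open>P\<close> so that error bounds do not depend on the shooting parameter.\<close>
lemma axis_field_lipschitz:
  assumes pos: "\<kappa> > 0" "G > 0" "\<Lambda> > 0" "M \<ge> 0" "c > 0" "Pmax \<ge> 0"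
  shows "\<exists>L. \<forall>P. \<bar>P\<bar> \<le> Pmax \<longrightarrow> L-lipschitz_on UNIV (axis_field \<kappa> G \<Lambda> M c P)"
proof -
  define L2 where "L2 = G * (1 / c^3 + 3 * (1 / \<kappa>) / c^3 * (1 + \<kappa>))"
  define L4 where "L4 = Pmax * (3 / c^4) + \<Lambda> * (1 / c^3 + 3 / c^3) + M * (1 / c^3 + 3 / c^3 * (1 + \<kappa>))"
  have L: "0 \<le> L2" "0 \<le> L4" using pos by (auto simp: L2_def L4_def)
  have "(1 + L2 + 1 + L4)-lipschitz_on UNIV (axis_field \<kappa> G \<Lambda> M c P)" if P: "\<bar>P\<bar> \<le> Pmax" for P
  proof (rule lipschitz_onI)
    fix z w :: "real \<times> real \<times> real \<times> real"
    obtain x p r q where z: "z = (x, p, r, q)" by (cases z)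
    obtain x' p' r' q' where w: "w = (x', p', r', q')" by (cases w)
    define D where "D = dist z w"
    have D: "\<bar>x - x'\<bar> \<le> D" "\<bar>p - p'\<bar> \<le> D" "\<bar>r - r'\<bar> \<le> D" "\<bar>q - q'\<bar> \<le> D"
    proof -
      have *: "norm (x - x', p - p', r - r', q - q') = D" by (simp add: D_def z w dist_norm)
      show "\<bar>x - x'\<bar> \<le> D" "\<bar>p - p'\<bar> \<le> D" "\<bar>r - r'\<bar> \<le> D" "\<bar>q - q'\<bar> \<le> D"
        using * norm_fst_le[of "x - x'" "(p - p', r - r', q - q')"]
          norm_snd_le[of "(p - p', r - r', q - q')" "x - x'"]
          norm_fst_le[of "p - p'" "(r - r', q - q')"] norm_snd_le[of "(r - r', q - q')" "p - p'"]
          norm_fst_le[of "r - r'" "q - q'"] norm_snd_le[of "q - q'" "r - r'"] by auto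
    qed
    have D0: "0 \<le> D" by (simp add: D_def)
    define R R' where RR: "R = max c r" "R' = max c r'"
    define h h' where hh: "h = axis_dist \<kappa> x R" "h' = axis_dist \<kappa> x' R'"
    have R: "c \<le> R" "c \<le> R'" "0 \<le> R" "0 \<le> R'" "\<bar>R - R'\<bar> \<le> D"
      using D pos by (auto simp: RR)
    have h: "c \<le> h" "c \<le> h'" "R \<le> h" "\<bar>x\<bar> \<le> 1 / \<kappa> * h"
      using axis_dist_ge[OF R(3), of \<kappa> x] axis_dist_ge[OF R(4), of \<kappa> x'] R pos
      by (auto simp: hh abs_mult field_simps)
    have hD: "\<bar>h - h'\<bar> \<le> (1 + \<kappa>) * D"
    proof -
      have "\<bar>h - h'\<bar> \<le> \<bar>R - R'\<bar> + \<kappa> * \<bar>x - x'\<bar>"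
        unfolding hh by (rule axis_dist_lipschitz[OF pos(1)])
      also have "\<dots> \<le> D + \<kappa> * D" using R D pos by (intro add_mono mult_left_mono) auto
      finally show ?thesis by (simp add: algebra_simps)
    qed
    have quot: "\<bar>u / a^3 - v / b^3\<bar> \<le> (1 / c^3 + 3 * C / c^3 * K) * D"
      if "c \<le> a" "c \<le> b" "\<bar>u\<bar> \<le> C * a" "\<bar>u - v\<bar> \<le> D" "\<bar>a - b\<bar> \<le> K * D" "0 \<le> C" for u v a b C K
    proof -
      have "\<bar>u / a^3 - v / b^3\<bar> \<le> \<bar>u - v\<bar> / c^3 + 3 * C / c^3 * \<bar>a - b\<bar>"
        using that pos by (intro divide_cube_lipschitz) auto
      also have "\<dots> \<le> D / c^3 + 3 * C / c^3 * (K * D)"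
        using that pos by (intro add_mono divide_right_mono mult_left_mono) auto
      finally show ?thesis by (simp add: algebra_simps)
    qed
    have x3: "\<bar>x / h^3 - x' / h'^3\<bar> \<le> (1 / c^3 + 3 * (1 / \<kappa>) / c^3 * (1 + \<kappa>)) * D"
      using h D hD pos by (intro quot) auto
    have R3: "\<bar>R / h^3 - R' / h'^3\<bar> \<le> (1 / c^3 + 3 * 1 / c^3 * (1 + \<kappa>)) * D"
      using h R hD by (intro quot) auto
    have R2: "\<bar>R / R^3 - R' / R'^3\<bar> \<le> (1 / c^3 + 3 * 1 / c^3 * 1) * D"
      using R by (intro quot) auto
    have R1: "\<bar>1 / R^3 - 1 / R'^3\<bar> \<le> 3 / c^4 * D"
      using order_trans[OF inverse_cube_lipschitz[OF pos(5) R(1,2)] mult_left_mono[OF R(5)]] by simp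
    have c2: "\<bar>- (G * x / h^3) - - (G * x' / h'^3)\<bar> \<le> L2 * D"
    proof -
      have "- (G * x / h^3) - - (G * x' / h'^3) = - (G * (x / h^3 - x' / h'^3))"
        by (simp add: algebra_simps)
      also have "\<bar>\<dots>\<bar> = G * \<bar>x / h^3 - x' / h'^3\<bar>" using pos by (simp add: abs_mult)
      finally show ?thesis unfolding L2_def using mult_left_mono[OF x3, of G] pos by (simp add: mult.assoc)
    qed
    have c4: "\<bar>(P / R^3 - \<Lambda> / R\<^sup>2 - M * R / h^3) - (P / R'^3 - \<Lambda> / R'\<^sup>2 - M * R' / h'^3)\<bar> \<le> L4 * D"
    proof -
      have sq: "\<Lambda> / R\<^sup>2 = \<Lambda> * (R / R^3)" "\<Lambda> / R'\<^sup>2 = \<Lambda> * (R' / R'^3)"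
        using R pos by (auto simp: power3_eq_cube power2_eq_square)
      have "(P / R^3 - \<Lambda> / R\<^sup>2 - M * R / h^3) - (P / R'^3 - \<Lambda> / R'\<^sup>2 - M * R' / h'^3)
        = P * (1 / R^3 - 1 / R'^3) - \<Lambda> * (R / R^3 - R' / R'^3) - M * (R / h^3 - R' / h'^3)"
        unfolding sq by (simp add: algebra_simps)
      also have "\<bar>\<dots>\<bar> \<le> \<bar>P\<bar> * \<bar>1 / R^3 - 1 / R'^3\<bar> + \<Lambda> * \<bar>R / R^3 - R' / R'^3\<bar> + M * \<bar>R / h^3 - R' / h'^3\<bar>"
        using pos by (intro order_trans[OF abs_triangle_ineq4] add_mono) (auto simp: abs_mult)
      also have "\<dots> \<le> Pmax * (3 / c^4 * D) + \<Lambda> * ((1 / c^3 + 3 * 1 / c^3 * 1) * D)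
          + M * ((1 / c^3 + 3 * 1 / c^3 * (1 + \<kappa>)) * D)"
        using P pos R1 R2 R3 by (intro add_mono mult_mono) auto
      also have "\<dots> = L4 * D" by (simp add: L4_def algebra_simps)
      finally show ?thesis .
    qed
    have "dist (axis_field \<kappa> G \<Lambda> M c P z) (axis_field \<kappa> G \<Lambda> M c P w)
      = norm (p - p', - (G * x / h^3) - - (G * x' / h'^3), q - q',
          (P / R^3 - \<Lambda> / R\<^sup>2 - M * R / h^3) - (P / R'^3 - \<Lambda> / R'\<^sup>2 - M * R' / h'^3))"
      by (simp add: dist_norm z w axis_field_def Let_def RR hh)
    also have "\<dots> \<le> D + (L2 * D + (D + L4 * D))"
      by (intro order_trans[OF norm_Pair_le] add_mono; (unfold real_norm_def)?; rule D c2 c4)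
    finally show "dist (axis_field \<kappa> G \<Lambda> M c P z) (axis_field \<kappa> G \<Lambda> M c P w)
        \<le> (1 + L2 + 1 + L4) * dist z w"
      by (simp add: D_def algebra_simps)
  qed (use L in auto)
  then show ?thesis by blast
qed

lemma axis_field_ex_lipschitz:
  assumes "\<kappa> > 0" "G > 0" "\<Lambda> > 0" "M \<ge> 0" "c > 0"
  shows "\<exists>L. L-lipschitz_on UNIV (axis_field \<kappa> G \<Lambda> M c P)"
  using axis_field_lipschitz[OF assms abs_ge_zero[of P]] by blast


lemma component_norms:
  fixes z w :: "real \<times> real \<times> real \<times> real"
  shows "\<bar>fst (snd z) - fst (snd w)\<bar> \<le> norm (z - w)"
    and "\<bar>fst (snd (snd z)) - fst (snd (snd w))\<bar> \<le> norm (z - w)"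
    and "\<bar>snd (snd (snd z)) - snd (snd (snd w))\<bar> \<le> norm (z - w)"
proof -
  obtain a b c d where e: "z - w = (a, b, c, d)" by (cases "z - w")
  have "fst (snd z) - fst (snd w) = b" "fst (snd (snd z)) - fst (snd (snd w)) = c"
    "snd (snd (snd z)) - snd (snd (snd w)) = d"
    using e by (metis fst_conv fst_diff snd_conv snd_diff)+
  then show "\<bar>fst (snd z) - fst (snd w)\<bar> \<le> norm (z - w)"
    "\<bar>fst (snd (snd z)) - fst (snd (snd w))\<bar> \<le> norm (z - w)"
    "\<bar>snd (snd (snd z)) - snd (snd (snd w))\<bar> \<le> norm (z - w)"
    unfolding e
    using norm_snd_le[of "(b, c, d)" a] norm_fst_le[of b "(c, d)"] norm_snd_le[of "(c, d)" b]
      norm_fst_le[of c d] norm_snd_le[of d c] by auto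
qed


section \<open>Orbits near the circular motion\<close>

text \<open>In the reduced problem \<open>\<kappa> = (M + m n) / (m n)\<close>, \<open>G = M + m n\<close> and \<open>\<Lambda> = m * lam n\<close>.
  For \<open>f = 0\<close> and \<open>r0\<^sup>2 a\<^sup>2 = r0 (\<Lambda> + M)\<close> the polygon rotates at the constant radius
  \<open>r0\<close>. Near this motion \<open>f\<close> oscillates with frequency \<open>\<omega>\<close> and \<open>r - r0\<close> with frequency \<open>\<nu>\<close>. Both
  perturbations, the initial vertical velocity \<open>\<epsilon>\<close> and the change \<open>\<epsilon> \<alpha>\<close> of \<open>a\<^sup>2\<close>, are
  measured by the same small \<open>\<epsilon>\<close>, which leaves \<open>\<alpha>\<close> in a fixed interval: \<open>ang\<close> is the
  resulting value of \<open>r0\<^sup>2 a\<^sup>2\<close>, and \<open>linear\<close> is the solution of the equations linearized at the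
  circular motion.\<close>
locale near_circular =
  fixes \<kappa> G \<Lambda> M r0 :: real
  assumes pos: "\<kappa> > 0" "G > 0" "\<Lambda> > 0" "M \<ge> 0" "r0 > 0"
begin

definition \<omega> :: real where "\<omega> = sqrt (G / r0^3)"
definition \<nu> :: real where "\<nu> = sqrt ((\<Lambda> + M) / r0^3)"
definition ang :: "real \<Rightarrow> real \<Rightarrow> real" where
  "ang \<epsilon> \<alpha> = r0 * (\<Lambda> + M) + \<epsilon> * \<alpha> * r0\<^sup>2"
definition linear :: "real \<Rightarrow> real \<Rightarrow> real \<Rightarrow> real \<times> real \<times> real \<times> real" where
  "linear \<epsilon> \<alpha> t =
     (\<epsilon> / \<omega> * sin (\<omega> * t), \<epsilon> * cos (\<omega> * t),
      r0 + \<epsilon> * \<alpha> / (r0 * \<nu>\<^sup>2) * (1 - cos (\<nu> * t)), \<epsilon> * \<alpha> / (r0 * \<nu>) * sin (\<nu> * t))"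
abbreviation field :: "real \<Rightarrow> real \<times> real \<times> real \<times> real \<Rightarrow> real \<times> real \<times> real \<times> real" where
  "field \<equiv> axis_field \<kappa> G \<Lambda> M (r0 / 2)"

lemma frequencies_pos: "\<omega> > 0" "\<nu> > 0"
  using pos by (auto simp: \<omega>_def \<nu>_def)

lemma frequencies_sq: "\<omega>\<^sup>2 = G / r0^3" "\<nu>\<^sup>2 = (\<Lambda> + M) / r0^3"
  using pos by (auto simp: \<omega>_def \<nu>_def)

text \<open>The defect of the linearization is of second order in \<open>\<epsilon>\<close>. Both the vertical and the radial
  component are combinations of differences of inverse cubes of \<open>h\<close>, \<open>R\<close> and \<open>r0\<close>. Where such a
  difference is only of first order, it carries another factor of first order; the attraction
  of the body on the axis gives \<open>1 / h ^ 3 - 1 / R ^ 3\<close>, which is itself of second order because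
  \<open>h\<^sup>2 - R\<^sup>2 = (\<kappa> x)\<^sup>2\<close>.\<close>
lemma field_defect_pointwise:
  assumes "0 \<le> \<epsilon>" "B * \<epsilon> \<le> r0 / 2" and \<alpha>: "\<bar>\<alpha>\<bar> \<le> 1"
    and x: "\<bar>x\<bar> \<le> A * \<epsilon>" and s: "\<bar>s\<bar> \<le> B * \<epsilon>"
  defines "R \<equiv> r0 + s" and "K \<equiv> 3 / (r0 / 2)^4"
  defines "h \<equiv> axis_dist \<kappa> x R"
  shows "\<bar>G * x / h^3 - \<omega>\<^sup>2 * x\<bar> \<le> G * A * K * (B + \<kappa> * A) * \<epsilon>\<^sup>2" (is ?vertical)
    and "\<bar>(ang \<epsilon> \<alpha> / R^3 - \<Lambda> / R\<^sup>2 - M * R / h^3) - (\<epsilon> * \<alpha> / r0 - \<nu>\<^sup>2 * s)\<bar>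
      \<le> (r0\<^sup>2 * K * B + (\<Lambda> + M) * B * K * B + M * (3 * (r0 / 2)) * K * (\<kappa>\<^sup>2 * A\<^sup>2 / (r0 / 2))) * \<epsilon>\<^sup>2"
      (is ?radial)
proof -
  define c where "c = r0 / 2"
  have c: "c > 0" using pos by (simp add: c_def)
  have K: "0 \<le> K" using pos by (simp add: K_def)
  have R: "c \<le> R" "R \<le> 3 * c" "0 < R" using s assms(2) pos by (auto simp: R_def c_def)
  have h: "R \<le> h" "c \<le> h" using axis_dist_ge[of R \<kappa> x] R by (auto simp: h_def)
  have hr0: "\<bar>h - r0\<bar> \<le> (B + \<kappa> * A) * \<epsilon>"
  proof -
    have "axis_dist \<kappa> 0 r0 = r0" using pos by (simp add: axis_dist_def)
    then have "\<bar>h - r0\<bar> \<le> \<bar>R - r0\<bar> + \<kappa> * \<bar>x - 0\<bar>"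
      unfolding h_def using axis_dist_lipschitz[OF pos(1), of x R 0 r0] by simp
    also have "\<dots> \<le> B * \<epsilon> + \<kappa> * (A * \<epsilon>)"
      using x s pos by (intro add_mono mult_left_mono) (auto simp: R_def)
    finally show ?thesis by (simp add: algebra_simps)
  qed
  have cube: "\<bar>1 / a^3 - 1 / b^3\<bar> \<le> K * d" if "c \<le> a" "c \<le> b" "\<bar>a - b\<bar> \<le> d" for a b d
    using inverse_cube_lipschitz[OF c that(1,2)] mult_left_mono[OF that(3) K]
    by (simp add: K_def c_def)
  have cr0: "c \<le> r0" using pos by (simp add: c_def)
  show ?vertical
  proof -
    have "G * x / h^3 - \<omega>\<^sup>2 * x = G * x * (1 / h^3 - 1 / r0^3)"
      by (simp add: frequencies_sq algebra_simps)
    also have "\<bar>\<dots>\<bar> = G * \<bar>x\<bar> * \<bar>1 / h^3 - 1 / r0^3\<bar>"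
      using pos by (simp add: abs_mult)
    also have "\<dots> \<le> G * (A * \<epsilon>) * (K * ((B + \<kappa> * A) * \<epsilon>))"
      using pos x cube[OF h(2) cr0 hr0] order_trans[OF abs_ge_zero x]
      by (intro mult_mono mult_left_mono) auto
    also have "\<dots> = G * A * K * (B + \<kappa> * A) * \<epsilon>\<^sup>2"
      by (simp add: power2_eq_square)
    finally show ?thesis .
  qed
  show ?radial
  proof -
    have Rr0: "\<bar>1 / R^3 - 1 / r0^3\<bar> \<le> K * (B * \<epsilon>)"
      using R s cr0 by (intro cube) (auto simp: R_def)
    have hR: "\<bar>1 / h^3 - 1 / R^3\<bar> \<le> K * (\<kappa>\<^sup>2 * A\<^sup>2 / c * \<epsilon>\<^sup>2)"
    proof (rule cube)
      have "(h - R) * c \<le> (h - R) * (h + R)"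
        using h R by (intro mult_left_mono) auto
      also have "\<dots> = (\<kappa> * x)\<^sup>2"
      proof -
        have "h\<^sup>2 = R\<^sup>2 + (\<kappa> * x)\<^sup>2" by (simp add: h_def axis_dist_def)
        then show ?thesis by (simp add: power2_eq_square algebra_simps)
      qed
      also have "\<dots> = \<kappa>\<^sup>2 * \<bar>x\<bar>\<^sup>2" by (simp add: power_mult_distrib)
      also have "\<dots> \<le> \<kappa>\<^sup>2 * (A * \<epsilon>)\<^sup>2"
        using x by (intro mult_left_mono power_mono) auto
      finally have "h - R \<le> \<kappa>\<^sup>2 * (A * \<epsilon>)\<^sup>2 / c" using c by (simp add: field_simps)
      then show "\<bar>h - R\<bar> \<le> \<kappa>\<^sup>2 * A\<^sup>2 / c * \<epsilon>\<^sup>2"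
        using h by (simp add: power_mult_distrib)
    qed (use h R in auto)
    have "(ang \<epsilon> \<alpha> / R^3 - \<Lambda> / R\<^sup>2 - M * R / h^3) - (\<epsilon> * \<alpha> / r0 - \<nu>\<^sup>2 * s)
       = \<epsilon> * \<alpha> * r0\<^sup>2 * (1 / R^3 - 1 / r0^3) - (\<Lambda> + M) * s * (1 / R^3 - 1 / r0^3)
         - M * R * (1 / h^3 - 1 / R^3)"
    proof -
      \<comment> \<open>Writing everything over cubes lets the terms of order zero and one cancel: the balance
        of forces on the circle is \<open>ang \<epsilon> 0 = r0 (\<Lambda> + M)\<close>, and \<open>R - r0 = s\<close>.\<close>
      have e: "\<epsilon> * \<alpha> / r0 = \<epsilon> * \<alpha> * r0\<^sup>2 * (1 / r0^3)"
        using pos by (simp add: power3_eq_cube power2_eq_square)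
      have l: "\<Lambda> / R\<^sup>2 = \<Lambda> * R * (1 / R^3)"
        using R by (simp add: power3_eq_cube power2_eq_square)
      define U V W where "U = 1 / R^3" and "V = 1 / r0^3" and "W = 1 / h^3"
      have "ang \<epsilon> \<alpha> * U - \<Lambda> * R * U - M * R * W - (\<epsilon> * \<alpha> * r0\<^sup>2 * V - (\<Lambda> + M) * V * s)
        = \<epsilon> * \<alpha> * r0\<^sup>2 * (U - V) - (\<Lambda> + M) * s * (U - V) - M * R * (W - U)"
        by (simp add: ang_def R_def algebra_simps)
      then show ?thesis
        unfolding e l frequencies_sq U_def V_def W_def by simp
    qed
    also have "\<bar>\<dots>\<bar> \<le> \<bar>\<epsilon> * \<alpha> * r0\<^sup>2\<bar> * \<bar>1 / R^3 - 1 / r0^3\<bar> + \<bar>(\<Lambda> + M) * s\<bar> * \<bar>1 / R^3 - 1 / r0^3\<bar>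
         + \<bar>M * R\<bar> * \<bar>1 / h^3 - 1 / R^3\<bar>"
    proof -
      have "\<bar>u - v - w\<bar> \<le> \<bar>u\<bar> + \<bar>v\<bar> + \<bar>w\<bar>" for u v w :: real by linarith
      then show ?thesis unfolding abs_mult[symmetric] .
    qed
    also have "\<dots> \<le> (\<epsilon> * r0\<^sup>2) * (K * (B * \<epsilon>)) + ((\<Lambda> + M) * (B * \<epsilon>)) * (K * (B * \<epsilon>))
         + (M * (3 * c)) * (K * (\<kappa>\<^sup>2 * A\<^sup>2 / c * \<epsilon>\<^sup>2))"
    proof (intro add_mono mult_mono Rr0 hR)
      show "\<bar>\<epsilon> * \<alpha> * r0\<^sup>2\<bar> \<le> \<epsilon> * r0\<^sup>2"
        using \<alpha> \<open>0 \<le> \<epsilon>\<close> mult_left_mono[OF \<alpha> \<open>0 \<le> \<epsilon>\<close>]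
        by (simp add: abs_mult mult_right_mono)
      show "\<bar>(\<Lambda> + M) * s\<bar> \<le> (\<Lambda> + M) * (B * \<epsilon>)"
        using s pos by (simp add: abs_mult mult_left_mono)
      show "\<bar>M * R\<bar> \<le> M * (3 * c)"
        using R pos by (simp add: abs_mult mult_left_mono)
      show "0 \<le> (\<Lambda> + M) * (B * \<epsilon>)"
        using order_trans[OF abs_ge_zero s] pos by simp
    qed (use pos c assms(1) in auto)
    also have "\<dots> = (r0\<^sup>2 * K * B + (\<Lambda> + M) * B * K * B + M * (3 * c) * K * (\<kappa>\<^sup>2 * A\<^sup>2 / c)) * \<epsilon>\<^sup>2"
      by (simp add: power2_eq_square algebra_simps)
    finally show ?thesis by (simp add: c_def)
  qed
qed

lemma linear_has_derivative:
  "(linear \<epsilon> \<alpha> has_vector_derivative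
     (\<epsilon> * cos (\<omega> * t), - \<omega>\<^sup>2 * (\<epsilon> / \<omega> * sin (\<omega> * t)), \<epsilon> * \<alpha> / (r0 * \<nu>) * sin (\<nu> * t),
      \<epsilon> * \<alpha> / r0 - \<nu>\<^sup>2 * (\<epsilon> * \<alpha> / (r0 * \<nu>\<^sup>2) * (1 - cos (\<nu> * t))))) (at t)"
proof -
  have [simp]: "\<omega> \<noteq> 0" "\<nu> \<noteq> 0" "r0 \<noteq> 0" using frequencies_pos pos by auto
  have 1: "((\<lambda>t. \<epsilon> / \<omega> * sin (\<omega> * t)) has_vector_derivative \<epsilon> * cos (\<omega> * t)) (at t)"
    "((\<lambda>t. \<epsilon> * cos (\<omega> * t)) has_vector_derivative - \<omega>\<^sup>2 * (\<epsilon> / \<omega> * sin (\<omega> * t))) (at t)"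
    "((\<lambda>t. r0 + \<epsilon> * \<alpha> / (r0 * \<nu>\<^sup>2) * (1 - cos (\<nu> * t))) has_vector_derivative
        \<epsilon> * \<alpha> / (r0 * \<nu>) * sin (\<nu> * t)) (at t)"
    "((\<lambda>t. \<epsilon> * \<alpha> / (r0 * \<nu>) * sin (\<nu> * t)) has_vector_derivative
        \<epsilon> * \<alpha> / r0 - \<nu>\<^sup>2 * (\<epsilon> * \<alpha> / (r0 * \<nu>\<^sup>2) * (1 - cos (\<nu> * t)))) (at t)"
    unfolding has_real_derivative_iff_has_vector_derivative[symmetric]
    by (auto intro!: derivative_eq_intros simp: field_simps power2_eq_square)
  show ?thesis
    unfolding linear_def by (intro has_vector_derivative_Pair 1)
qed

lemma linear_defect:
  "\<exists>C\<ge>0. \<exists>B\<ge>0. \<forall>\<epsilon>\<ge>0. \<forall>\<alpha>. \<bar>\<alpha>\<bar> \<le> 1 \<longrightarrow> B * \<epsilon> \<le> r0 / 2 \<longrightarrow>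
     (\<forall>t. \<bar>fst (snd (snd (linear \<epsilon> \<alpha> t))) - r0\<bar> \<le> B * \<epsilon> \<and>
       norm (field (ang \<epsilon> \<alpha>) (linear \<epsilon> \<alpha> t) - vector_derivative (linear \<epsilon> \<alpha>) (at t)) \<le> C * \<epsilon>\<^sup>2)"
proof -
  define A where "A = 1 / \<omega>"
  define B where "B = 2 / (r0 * \<nu>\<^sup>2)"
  define K where "K = 3 / (r0 / 2)^4"
  define C1 where "C1 = G * A * K * (B + \<kappa> * A)"
  define C2 where "C2 = r0\<^sup>2 * K * B + (\<Lambda> + M) * B * K * B + M * (3 * (r0 / 2)) * K * (\<kappa>\<^sup>2 * A\<^sup>2 / (r0 / 2))"
  have nn: "0 \<le> A" "0 \<le> B" "0 \<le> K" "0 \<le> C1" "0 \<le> C2"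
    using pos frequencies_pos by (auto simp: A_def B_def K_def C1_def C2_def)
  have main: "\<bar>fst (snd (snd (linear \<epsilon> \<alpha> t))) - r0\<bar> \<le> B * \<epsilon> \<and>
       norm (field (ang \<epsilon> \<alpha>) (linear \<epsilon> \<alpha> t) - vector_derivative (linear \<epsilon> \<alpha>) (at t)) \<le> (C1 + C2) * \<epsilon>\<^sup>2"
    if \<epsilon>: "0 \<le> \<epsilon>" "B * \<epsilon> \<le> r0 / 2" and \<alpha>: "\<bar>\<alpha>\<bar> \<le> 1" for \<epsilon> \<alpha> t
  proof -
    define x where "x = \<epsilon> / \<omega> * sin (\<omega> * t)"
    define s where "s = \<epsilon> * \<alpha> / (r0 * \<nu>\<^sup>2) * (1 - cos (\<nu> * t))"
    define p q where "p = \<epsilon> * cos (\<omega> * t)" and "q = \<epsilon> * \<alpha> / (r0 * \<nu>) * sin (\<nu> * t)"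
    have lin: "linear \<epsilon> \<alpha> t = (x, p, r0 + s, q)"
      by (simp add: linear_def x_def s_def p_def q_def)
    have x: "\<bar>x\<bar> \<le> A * \<epsilon>"
    proof -
      have "\<bar>x\<bar> = (\<epsilon> / \<omega>) * \<bar>sin (\<omega> * t)\<bar>"
        using \<epsilon> frequencies_pos by (simp add: x_def abs_mult)
      also have "\<dots> \<le> (\<epsilon> / \<omega>) * 1"
        using \<epsilon> frequencies_pos by (intro mult_left_mono) auto
      finally show ?thesis by (simp add: A_def)
    qed
    have s: "\<bar>s\<bar> \<le> B * \<epsilon>"
    proof -
      have "\<bar>1 - cos (\<nu> * t)\<bar> \<le> 2"
        using cos_le_one[of "\<nu> * t"] cos_ge_minus_one[of "\<nu> * t"] by linarith
      then have "\<bar>\<alpha>\<bar> * \<bar>1 - cos (\<nu> * t)\<bar> \<le> 1 * 2"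
        using \<alpha> by (intro mult_mono) auto
      then have "(\<epsilon> / (r0 * \<nu>\<^sup>2)) * (\<bar>\<alpha>\<bar> * \<bar>1 - cos (\<nu> * t)\<bar>) \<le> (\<epsilon> / (r0 * \<nu>\<^sup>2)) * (1 * 2)"
        using \<epsilon> pos by (intro mult_left_mono) auto
      then show ?thesis
        using \<epsilon> pos by (simp add: s_def B_def abs_mult mult_ac)
    qed
    note d = field_defect_pointwise[OF \<epsilon> \<alpha> x s, folded K_def, folded C1_def C2_def]
    have max: "max (r0 / 2) (r0 + s) = r0 + s"
      using s \<epsilon> by (auto simp: max_def)
    let ?h = "axis_dist \<kappa> x (r0 + s)"
    have "vector_derivative (linear \<epsilon> \<alpha>) (at t) = (p, - \<omega>\<^sup>2 * x, q, \<epsilon> * \<alpha> / r0 - \<nu>\<^sup>2 * s)"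
      using vector_derivative_at[OF linear_has_derivative[of \<epsilon> \<alpha> t]]
      by (simp add: x_def s_def p_def q_def)
    then have "norm (field (ang \<epsilon> \<alpha>) (linear \<epsilon> \<alpha> t) - vector_derivative (linear \<epsilon> \<alpha>) (at t))
       = norm (0::real, - (G * x / ?h^3 - \<omega>\<^sup>2 * x), 0::real,
          (ang \<epsilon> \<alpha> / (r0 + s)^3 - \<Lambda> / (r0 + s)\<^sup>2 - M * (r0 + s) / ?h^3) - (\<epsilon> * \<alpha> / r0 - \<nu>\<^sup>2 * s))"
      by (simp add: lin axis_field_def Let_def max)
    also have "\<dots> \<le> 0 + (C1 * \<epsilon>\<^sup>2 + (0 + C2 * \<epsilon>\<^sup>2))"
      using d by (intro order_trans[OF norm_Pair_le] add_mono) auto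
    finally show ?thesis using s lin by (simp add: algebra_simps)
  qed
  show ?thesis
    using main nn by (intro exI[of _ "C1 + C2"] exI[of _ B] conjI) auto
qed

lemma field_parameter_dependence:
  "norm (field P z - field Q z) \<le> \<bar>P - Q\<bar> / (r0 / 2)^3"
proof -
  obtain x p r q where z: "z = (x, p, r, q)" by (cases z)
  define R where "R = max (r0 / 2) r"
  have R: "r0 / 2 \<le> R" "0 < R" using pos by (auto simp: R_def)
  have "field P z - field Q z = (0, 0, 0, (P - Q) / R^3)"
    by (simp add: z axis_field_def Let_def R_def[symmetric] diff_divide_distrib zero_prod_def)
  then have "norm (field P z - field Q z) = \<bar>P - Q\<bar> / R^3"
    using R by (simp add: norm_Pair)
  also have "\<dots> \<le> \<bar>P - Q\<bar> / (r0 / 2)^3"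
    using R pos by (intro divide_left_mono power_mono mult_pos_pos) auto
  finally show ?thesis .
qed

text \<open>The shooting argument. After division by \<open>\<epsilon>\<close> the velocities \<open>(f', r')\<close> at time \<open>T\<close> differ by
  \<open>O(\<epsilon>)\<close> from \<open>(cos (\<omega> T), \<alpha> sin (\<nu> T) / (r0 \<nu>))\<close>. The first entry changes sign as \<open>T\<close> crosses
  \<open>pi / (2 \<omega>)\<close>; by non-resonance the second is nonzero there for \<open>\<alpha> \<noteq> 0\<close> and changes sign with \<open>\<alpha>\<close>.
  For small \<open>\<epsilon>\<close> these signs survive on the sides of a rectangle of pairs \<open>(T, \<alpha>)\<close>, and the
  Poincare-Miranda theorem yields a common zero.\<close>
lemma quarter_period_orbit:
  assumes nonres: "sin (\<nu> * (pi / (2 * \<omega>))) \<noteq> 0" and "\<delta> > 0"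
  shows "\<exists>\<epsilon> \<alpha> T z. 0 < \<epsilon> \<and> \<epsilon> < \<delta> \<and> \<bar>\<alpha>\<bar> \<le> 1 \<and> 0 < T \<and> \<bar>T - pi / (2 * \<omega>)\<bar> < \<delta> \<and>
     z 0 = (0, \<epsilon>, r0, 0) \<and> (\<forall>t. (z has_vector_derivative field (ang \<epsilon> \<alpha>) (z t)) (at t)) \<and>
     fst (snd (z T)) = 0 \<and> snd (snd (snd (z T))) = 0 \<and>
     (\<forall>t\<in>{0..T}. r0 / 2 \<le> fst (snd (snd (z t))))"
proof -
  define T0 where "T0 = pi / (2 * \<omega>)"
  have T0: "0 < T0" "\<omega> * T0 = pi / 2" using frequencies_pos by (auto simp: T0_def)
  define s0 where "s0 = \<bar>sin (\<nu> * T0)\<bar> / 2"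
  have s0: "0 < s0" using nonres by (simp add: s0_def T0_def)
  define \<sigma> where "\<sigma> = sgn (sin (\<nu> * T0))"
  have "isCont (\<lambda>t. sin (\<nu> * t)) T0" by (intro continuous_intros)
  then obtain \<eta>1 where \<eta>1: "\<eta>1 > 0" "\<And>t. \<bar>t - T0\<bar> < \<eta>1 \<Longrightarrow> \<bar>sin (\<nu> * t) - sin (\<nu> * T0)\<bar> < s0"
    using s0 unfolding continuous_at_eps_delta dist_real_def by blast
  \<comment> \<open>Half-width of the time window: it keeps \<open>sin (\<nu> t)\<close> away from zero with one sign, and
    \<open>\<omega> \<eta> < pi\<close>.\<close>
  define \<eta> where "\<eta> = min (min (\<eta>1 / 2) (\<delta> / 2)) (T0 / 2)"
  have \<eta>: "0 < \<eta>" "\<eta> < \<eta>1" "\<eta> < \<delta>" "\<eta> \<le> T0 / 2" using \<eta>1 T0 \<open>\<delta> > 0\<close> by (auto simp: \<eta>_def)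
  have sgn: "\<sigma> * sin (\<nu> * t) \<ge> s0" if "t \<in> {T0 - \<eta>..T0 + \<eta>}" for t
  proof -
    have "\<bar>sin (\<nu> * t) - sin (\<nu> * T0)\<bar> < s0" using that \<eta> by (intro \<eta>1) auto
    then show ?thesis using s0 by (auto simp: \<sigma>_def s0_def sgn_if abs_if split: if_splits)
  qed
  have \<sigma>: "\<bar>\<sigma>\<bar> = 1" using s0 by (auto simp: \<sigma>_def s0_def sgn_if)
  \<comment> \<open>The size of \<open>cos (\<omega> t)\<close> at both ends of the window.\<close>
  define c0 where "c0 = sin (\<omega> * \<eta>)"
  have c0: "0 < c0" "cos (\<omega> * (T0 - \<eta>)) = c0" "cos (\<omega> * (T0 + \<eta>)) = - c0"
  proof -
    have "\<omega> * \<eta> \<le> \<omega> * (T0 / 2)" using \<eta> frequencies_pos by (intro mult_left_mono) auto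
    also have "\<dots> = \<omega> * T0 / 2" by simp
    also have "\<dots> = pi / 4" unfolding T0(2) by simp
    finally have "\<omega> * \<eta> < pi" using pi_gt_zero by linarith
    then show "0 < c0" unfolding c0_def using \<eta> frequencies_pos by (intro sin_gt_zero) auto
    show "cos (\<omega> * (T0 - \<eta>)) = c0" "cos (\<omega> * (T0 + \<eta>)) = - c0"
      by (simp_all add: c0_def right_diff_distrib distrib_left T0 cos_add cos_diff)
  qed
  define T1 where "T1 = T0 + \<eta>"
  obtain C B where C: "C \<ge> 0" and B: "B \<ge> 0" and
    lin: "\<And>\<epsilon> \<alpha> t. 0 \<le> \<epsilon> \<Longrightarrow> \<bar>\<alpha>\<bar> \<le> 1 \<Longrightarrow> B * \<epsilon> \<le> r0 / 2 \<Longrightarrow>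
       \<bar>fst (snd (snd (linear \<epsilon> \<alpha> t))) - r0\<bar> \<le> B * \<epsilon> \<and>
       norm (field (ang \<epsilon> \<alpha>) (linear \<epsilon> \<alpha> t) - vector_derivative (linear \<epsilon> \<alpha>) (at t)) \<le> C * \<epsilon>\<^sup>2"
    using linear_defect by blast
  define Pmax where "Pmax = r0 * (\<Lambda> + M) + r0\<^sup>2"
  have "0 \<le> Pmax" using pos by (simp add: Pmax_def)
  then obtain L where L: "\<And>P. \<bar>P\<bar> \<le> Pmax \<Longrightarrow> L-lipschitz_on UNIV (field P)"
    using axis_field_lipschitz[of \<kappa> G \<Lambda> M "r0 / 2" Pmax] pos by auto
  have L0: "0 \<le> L" using lipschitz_on_nonneg[OF L[of 0]] \<open>0 \<le> Pmax\<close> by simp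
  define D where "D = C * exp ((L + 1) * T1)"
  have D: "0 \<le> D" using C by (simp add: D_def)
  \<comment> \<open>A lower bound for \<open>|sin (\<nu> t)| / (r0 \<nu>)\<close> on the window.\<close>
  define k where "k = s0 / (r0 * \<nu>)"
  have k: "0 < k" using s0 pos frequencies_pos by (simp add: k_def)
  \<comment> \<open>The error of the linearization is at most \<open>D \<epsilon>\<^sup>2\<close>. It must be smaller than the leading
    terms \<open>\<epsilon> c0\<close> and \<open>\<epsilon> k\<close>, and together with the oscillation \<open>B \<epsilon>\<close> it must not bring the radius
    below \<open>r0 / 2\<close>.\<close>
  define \<epsilon> where "\<epsilon> = min (min (min (1/2) (\<delta> / 2)) (r0 / (2 * (B + D + 1)))) (min (c0 / (D + 1)) (k / (D + 1)))"
  have \<epsilon>: "0 < \<epsilon>" "\<epsilon> < 1" "\<epsilon> < \<delta>" "\<epsilon> * (B + D + 1) \<le> r0 / 2" "\<epsilon> * (D + 1) \<le> c0" "\<epsilon> * (D + 1) \<le> k"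
  proof -
    show "0 < \<epsilon>" using \<open>\<delta> > 0\<close> B D c0 k pos by (auto simp: \<epsilon>_def)
    show "\<epsilon> < 1" "\<epsilon> < \<delta>" using \<open>\<delta> > 0\<close> by (auto simp: \<epsilon>_def)
    have "\<epsilon> \<le> r0 / (2 * (B + D + 1))" "\<epsilon> \<le> c0 / (D + 1)" "\<epsilon> \<le> k / (D + 1)"
      by (auto simp: \<epsilon>_def)
    then show "\<epsilon> * (B + D + 1) \<le> r0 / 2" "\<epsilon> * (D + 1) \<le> c0" "\<epsilon> * (D + 1) \<le> k"
      using B D by (auto simp: field_simps)
  qed
  have ang: "\<bar>ang \<epsilon> \<alpha>\<bar> \<le> Pmax" if "\<bar>\<alpha>\<bar> \<le> 1" for \<alpha>
  proof -
    have "\<bar>\<epsilon> * \<alpha>\<bar> \<le> 1" using that \<epsilon> mult_mono[of \<epsilon> 1 "\<bar>\<alpha>\<bar>" 1] by (simp add: abs_mult)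
    then have "\<bar>\<epsilon> * \<alpha>\<bar> * r0\<^sup>2 \<le> 1 * r0\<^sup>2" by (intro mult_right_mono) auto
    moreover have "\<bar>ang \<epsilon> \<alpha>\<bar> \<le> r0 * (\<Lambda> + M) + \<bar>\<epsilon> * \<alpha>\<bar> * r0\<^sup>2"
      unfolding ang_def using pos
      by (intro order_trans[OF abs_triangle_ineq]) (simp add: abs_mult)
    ultimately show ?thesis by (simp add: Pmax_def)
  qed
  note lip = L[OF ang]
  have "\<exists>z. z 0 = (0, \<epsilon>, r0, 0) \<and> (\<forall>t. (z has_vector_derivative field (ang \<epsilon> \<alpha>) (z t)) (at t))"
    if "\<bar>\<alpha>\<bar> \<le> 1" for \<alpha>
    using lipschitz_ode_global_solution[OF lip[OF that]] .
  then obtain z where z0: "\<And>\<alpha>. \<bar>\<alpha>\<bar> \<le> 1 \<Longrightarrow> z \<alpha> 0 = (0, \<epsilon>, r0, 0)"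
    and z: "\<And>\<alpha> t. \<bar>\<alpha>\<bar> \<le> 1 \<Longrightarrow> (z \<alpha> has_vector_derivative field (ang \<epsilon> \<alpha>) (z \<alpha> t)) (at t)"
    by metis
  have close: "norm (z \<alpha> t - linear \<epsilon> \<alpha> t) \<le> \<epsilon> * (\<epsilon> * D)"
    if \<alpha>: "\<bar>\<alpha>\<bar> \<le> 1" and t: "0 \<le> t" "t \<le> T1" for \<alpha> t
  proof -
    have "\<epsilon> * (B + D + 1) = B * \<epsilon> + \<epsilon> * D + \<epsilon>" "0 \<le> \<epsilon> * D"
      using \<epsilon>(1) D by (simp_all add: algebra_simps)
    then have "B * \<epsilon> \<le> r0 / 2" using \<epsilon>(1,4) by linarith
    then have "norm (z \<alpha> t - linear \<epsilon> \<alpha> t) \<le> (C * \<epsilon>\<^sup>2) * exp ((L + 1) * (t - 0))"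
      using lin[of \<epsilon> \<alpha>] C \<epsilon> \<alpha> t z0[OF \<alpha>]
      by (intro lipschitz_ode_defect[OF _ _ lip[OF \<alpha>] z[OF \<alpha>]
            vector_derivative_works[THEN iffD1, OF differentiableI_vector[OF linear_has_derivative]]])
         (auto simp: linear_def)
    also have "\<dots> \<le> (C * \<epsilon>\<^sup>2) * exp ((L + 1) * T1)"
      using C t L0 by (intro mult_left_mono) (auto intro: mult_left_mono)
    finally show ?thesis by (simp add: D_def power2_eq_square mult_ac)
  qed
  have cont: "continuous_on ({T0 - \<eta>..T0 + \<eta>} \<times> {-1..1}) (\<lambda>(t, \<alpha>). z \<alpha> t)"
  proof (rule continuous_on_TimesI)
    show "continuous_on {T0 - \<eta>..T0 + \<eta>} (\<lambda>t. z \<alpha> t)" if "\<alpha> \<in> {-1..1}" for \<alpha>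
    proof -
      have "\<bar>\<alpha>\<bar> \<le> 1" using that by auto
      from has_vector_derivative_continuous[OF z[OF this]] show ?thesis
        by (intro continuous_at_imp_continuous_on ballI)
    qed
    define N where "N = \<epsilon> * r0\<^sup>2 / (r0 / 2)^3"
    have N: "0 \<le> N" using \<epsilon> pos by (simp add: N_def)
    have "(N * exp ((L + 1) * T1))-lipschitz_on {-1..1} (\<lambda>\<alpha>. z \<alpha> t)"
      if "t \<in> {T0 - \<eta>..T0 + \<eta>}" for t
    proof (rule lipschitz_onI)
      fix \<alpha> \<beta> :: real assume "\<alpha> \<in> {-1..1}" "\<beta> \<in> {-1..1}"
      then have ab: "\<bar>\<alpha>\<bar> \<le> 1" "\<bar>\<beta>\<bar> \<le> 1" by auto
      have t: "0 \<le> t" "t \<le> T1" using that \<eta> T0 by (auto simp: T1_def)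
      have N1: "norm (field (ang \<epsilon> \<alpha>) y - field (ang \<epsilon> \<beta>) y) \<le> N * \<bar>\<alpha> - \<beta>\<bar>" for y
      proof -
        have "ang \<epsilon> \<alpha> - ang \<epsilon> \<beta> = \<epsilon> * r0\<^sup>2 * (\<alpha> - \<beta>)" by (simp add: ang_def algebra_simps)
        then show ?thesis
          using field_parameter_dependence[of "ang \<epsilon> \<alpha>" y "ang \<epsilon> \<beta>"] \<epsilon>
          by (simp add: N_def abs_mult)
      qed
      have "norm (z \<alpha> t - z \<beta> t) \<le> (N * \<bar>\<alpha> - \<beta>\<bar>) * exp ((L + 1) * (t - 0))"
        using t N z0 ab by (intro lipschitz_ode_defect[OF _ _ lip[OF ab(1)] z[OF ab(1)] z[OF ab(2)]] N1) auto
      also have "\<dots> \<le> (N * \<bar>\<alpha> - \<beta>\<bar>) * exp ((L + 1) * T1)"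
        using N t L0 by (intro mult_left_mono) (auto intro: mult_left_mono)
      finally show "dist (z \<alpha> t) (z \<beta> t) \<le> N * exp ((L + 1) * T1) * dist \<alpha> \<beta>"
        by (simp add: dist_norm mult_ac)
    qed (use N in auto)
    then show "local_lipschitz {T0 - \<eta>..T0 + \<eta>} {-1..1} (\<lambda>t \<alpha>. z \<alpha> t)"
      unfolding local_lipschitz_def
      by (meson Int_iff Int_lower2 lipschitz_on_subset zero_less_one)
  qed
  \<comment> \<open>The factor \<open>- \<sigma>\<close> makes the displacement \<open>v\<close> point inwards at \<open>\<alpha> = 1\<close> and \<open>\<alpha> = -1\<close>.\<close>
  define u where "u w = fst (snd (z (snd w) (fst w)))" for w
  define v where "v w = - \<sigma> * snd (snd (snd (z (snd w) (fst w))))" for w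
  have cu: "continuous_on ({T0 - \<eta>..T0 + \<eta>} \<times> {-1..1}) u"
    "continuous_on ({T0 - \<eta>..T0 + \<eta>} \<times> {-1..1}) v"
    using cont unfolding u_def v_def case_prod_unfold by (auto intro!: continuous_intros)
  have u_close: "\<bar>u (t, \<alpha>) - \<epsilon> * cos (\<omega> * t)\<bar> < \<epsilon> * c0"
    and v_close: "\<bar>v (t, \<alpha>) + \<epsilon> * \<alpha> / (r0 * \<nu>) * (\<sigma> * sin (\<nu> * t))\<bar> < \<epsilon> * k"
    if "t \<in> {T0 - \<eta>..T0 + \<eta>}" "\<alpha> \<in> {-1..1}" for t \<alpha>
  proof -
    have t: "\<bar>\<alpha>\<bar> \<le> 1" "0 \<le> t" "t \<le> T1" using that \<eta> T0 by (auto simp: T1_def)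
    have D1: "\<epsilon> * (\<epsilon> * D) < \<epsilon> * c0" "\<epsilon> * (\<epsilon> * D) < \<epsilon> * k"
      using \<epsilon> by (auto simp: algebra_simps)
    have "\<bar>u (t, \<alpha>) - \<epsilon> * cos (\<omega> * t)\<bar> \<le> norm (z \<alpha> t - linear \<epsilon> \<alpha> t)"
      using component_norms(1)[of "z \<alpha> t" "linear \<epsilon> \<alpha> t"] by (simp add: u_def linear_def)
    then show "\<bar>u (t, \<alpha>) - \<epsilon> * cos (\<omega> * t)\<bar> < \<epsilon> * c0"
      using close[OF t] D1 by linarith
    have "v (t, \<alpha>) + \<epsilon> * \<alpha> / (r0 * \<nu>) * (\<sigma> * sin (\<nu> * t))
        = - \<sigma> * (snd (snd (snd (z \<alpha> t))) - snd (snd (snd (linear \<epsilon> \<alpha> t))))"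
      by (simp add: v_def linear_def algebra_simps)
    then have "\<bar>v (t, \<alpha>) + \<epsilon> * \<alpha> / (r0 * \<nu>) * (\<sigma> * sin (\<nu> * t))\<bar> \<le> norm (z \<alpha> t - linear \<epsilon> \<alpha> t)"
      using component_norms(3)[of "z \<alpha> t" "linear \<epsilon> \<alpha> t"] \<sigma> by (simp add: abs_mult)
    then show "\<bar>v (t, \<alpha>) + \<epsilon> * \<alpha> / (r0 * \<nu>) * (\<sigma> * sin (\<nu> * t))\<bar> < \<epsilon> * k"
      using close[OF t] D1 by linarith
  qed
  have vk: "\<epsilon> * k \<le> \<epsilon> / (r0 * \<nu>) * (\<sigma> * sin (\<nu> * t))" if "t \<in> {T0 - \<eta>..T0 + \<eta>}" for t
    using mult_left_mono[OF sgn[OF that], of "\<epsilon> / (r0 * \<nu>)"] \<epsilon> pos frequencies_pos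
    by (simp add: k_def)
  have "\<exists>T\<in>{T0 - \<eta>..T0 + \<eta>}. \<exists>\<alpha>\<in>{-1..1}. u (T, \<alpha>) = 0 \<and> v (T, \<alpha>) = 0"
  proof (rule poincare_miranda_rectangle[OF _ _ cu])
    fix \<alpha> :: real assume "\<alpha> \<in> {-1..1}"
    then show "u (T0 - \<eta>, \<alpha>) > 0" "u (T0 + \<eta>, \<alpha>) < 0"
      using u_close[of "T0 - \<eta>" \<alpha>] u_close[of "T0 + \<eta>" \<alpha>] c0 \<eta> by auto
  next
    fix t assume t: "t \<in> {T0 - \<eta>..T0 + \<eta>}"
    show "v (t, -1) > 0" "v (t, 1) < 0"
      using v_close[OF t, of "-1"] v_close[OF t, of 1] vk[OF t] by auto
  qed (use \<eta> in auto)
  then obtain T \<alpha> where T: "T \<in> {T0 - \<eta>..T0 + \<eta>}" and "\<alpha> \<in> {-1..1}"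
    and zero: "u (T, \<alpha>) = 0" "v (T, \<alpha>) = 0" by blast
  then have \<alpha>: "\<bar>\<alpha>\<bar> \<le> 1" by auto
  have "r0 / 2 \<le> fst (snd (snd (z \<alpha> t)))" if "t \<in> {0..T}" for t
  proof -
    have t: "0 \<le> t" "t \<le> T1" using that T by (auto simp: T1_def)
    have e: "\<epsilon> * (\<epsilon> * D) \<le> \<epsilon> * D"
      using \<epsilon> D mult_right_mono[of \<epsilon> 1 "\<epsilon> * D"] by simp
    have sum: "\<epsilon> * B + \<epsilon> * D \<le> r0 / 2" "0 \<le> \<epsilon> * D" using \<epsilon> D by (auto simp: algebra_simps)
    then have "\<bar>fst (snd (snd (linear \<epsilon> \<alpha> t))) - r0\<bar> \<le> \<epsilon> * B"
      using lin[of \<epsilon> \<alpha> t] \<epsilon> \<alpha> by (simp add: mult.commute)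
    then show ?thesis
      using component_norms(2)[of "z \<alpha> t" "linear \<epsilon> \<alpha> t"] close[OF \<alpha> t] e sum by linarith
  qed
  moreover have "fst (snd (z \<alpha> T)) = 0" "snd (snd (snd (z \<alpha> T))) = 0"
    using zero \<sigma> by (auto simp: u_def v_def)
  moreover have "0 < T" "\<bar>T - pi / (2 * \<omega>)\<bar> < \<delta>"
    using T \<eta> T0 unfolding T0_def[symmetric] by auto
  ultimately show ?thesis
    using \<epsilon> \<alpha> z0[OF \<alpha>] z[OF \<alpha>]
    by (intro exI[of _ \<epsilon>] exI[of _ \<alpha>] exI[of _ T] exI[of _ "z \<alpha>"]) auto
qed

end

section \<open>From a quarter period to all times\<close>

text \<open>The reflections about \<open>0\<close> and \<open>T\<close> generate a group for which \<open>{0..T}\<close> is a fundamental domain.\<close>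
lemma lower_bound_by_reflections:
  fixes r :: "real \<Rightarrow> real"
  assumes "0 < T" and r0: "\<And>t. r (- t) = r t" and rT: "\<And>t. r (2 * T - t) = r t"
    and bound: "\<And>t. t \<in> {0..T} \<Longrightarrow> c \<le> r t"
  shows "c \<le> r t"
proof -
  interpret periodic_fun_simple r "2 * T"
  proof
    fix t show "r (t + 2 * T) = r t" using rT[of "- t"] r0[of t] by (simp add: add.commute)
  qed
  \<comment> \<open>The translate of \<open>t\<close> by a multiple of the period \<open>2 T\<close> that lies in \<open>{-T..<T}\<close>.\<close>
  define k where "k = \<lfloor>(t + T) / (2 * T)\<rfloor>"
  define s where "s = t - of_int k * (2 * T)"
  have "of_int k \<le> (t + T) / (2 * T)" "(t + T) / (2 * T) < of_int k + 1"
    unfolding k_def by linarith+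
  then have "- T \<le> s" "s \<le> T"
    using \<open>0 < T\<close> by (auto simp: s_def field_simps)
  then have "c \<le> r \<bar>s\<bar>" by (intro bound) auto
  moreover have "r \<bar>s\<bar> = r s" using r0[of s] by (auto simp: abs_if)
  moreover have "r s = r t" unfolding s_def by (rule minus_of_int)
  ultimately show ?thesis by simp
qed


text \<open>The equations are reversible in two ways: reversing time preserves them, and this may be combined
  with \<open>f \<mapsto> - f\<close>. The initial state is fixed by the second reversor and the state at
  \<open>T\<close> by the first. Composing the two reflections of time shows that \<open>f\<close> changes sign and \<open>r\<close>
  returns after \<open>2 T\<close>, so both have period \<open>4 T\<close>. The symmetries also carry the bound
  \<open>c \<le> r\<close> from the quarter period to all times, so the clamp is never active.\<close>
lemma reflected_quarter_orbit_periodic: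
  fixes z :: "real \<Rightarrow> real \<times> real \<times> real \<times> real"
  assumes F: "L-lipschitz_on UNIV (axis_field \<kappa> G \<Lambda> M c P)"
    and z: "\<And>t. (z has_vector_derivative axis_field \<kappa> G \<Lambda> M c P (z t)) (at t)"
    and z0: "fst (z 0) = 0" "snd (snd (snd (z 0))) = 0"
    and T: "0 < T" "fst (snd (z T)) = 0" "snd (snd (snd (z T))) = 0"
    and c: "\<And>t. t \<in> {0..T} \<Longrightarrow> c \<le> fst (snd (snd (z t)))"
  shows "fst (z (t + 4 * T)) = fst (z t)"
    and "fst (snd (snd (z (t + 4 * T)))) = fst (snd (snd (z t)))"
    and "c \<le> fst (snd (snd (z t)))"
proof -
  define S0 S1 :: "real \<times> real \<times> real \<times> real \<Rightarrow> real \<times> real \<times> real \<times> real" where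
    "S0 w = (- fst w, fst (snd w), fst (snd (snd w)), - snd (snd (snd w)))" and
    "S1 w = (fst w, - fst (snd w), fst (snd (snd w)), - snd (snd (snd w)))" for w
  have lin: "bounded_linear S0" "bounded_linear S1"
    unfolding S0_def S1_def
    by (intro bounded_linear_Pair bounded_linear_minus bounded_linear_fst bounded_linear_snd
        bounded_linear_compose[OF bounded_linear_fst] bounded_linear_compose[OF bounded_linear_snd])+
  have rev: "axis_field \<kappa> G \<Lambda> M c P (S0 w) = - S0 (axis_field \<kappa> G \<Lambda> M c P w)"
    "axis_field \<kappa> G \<Lambda> M c P (S1 w) = - S1 (axis_field \<kappa> G \<Lambda> M c P w)" for w
    by (auto simp: S0_def S1_def axis_field_def Let_def axis_dist_def case_prod_unfold)
  have "S0 (z 0) = z 0" "S1 (z T) = z T"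
    using z0 T by (auto simp: S0_def S1_def prod_eq_iff)
  then have S: "S0 (z (- t)) = z t" "S1 (z (2 * T - t)) = z t" for t
    using reversible_ode_symmetric[OF F lin(1) rev(1) z, of 0 t]
      reversible_ode_symmetric[OF F lin(2) rev(2) z, of T t] by auto
  have x: "fst (z (- t)) = - fst (z t)" "fst (z (2 * T - t)) = fst (z t)"
    and r: "fst (snd (snd (z (- t)))) = fst (snd (snd (z t)))"
      "fst (snd (snd (z (2 * T - t)))) = fst (snd (snd (z t)))" for t
    using S[of t] by (auto simp: S0_def S1_def prod_eq_iff)
  have r2: "fst (snd (snd (z (t + 2 * T)))) = fst (snd (snd (z t)))"
    and x2: "fst (z (t + 2 * T)) = - fst (z t)" for t
    using r(2)[of "- t"] r(1)[of t] x(2)[of "- t"] x(1)[of t] by (auto simp: add.commute)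
  have "t + 4 * T = (t + 2 * T) + 2 * T" by simp
  then show "fst (z (t + 4 * T)) = fst (z t)"
    "fst (snd (snd (z (t + 4 * T)))) = fst (snd (snd (z t)))"
    by (simp_all only: r2 x2 minus_minus)
  show "c \<le> fst (snd (snd (z t)))"
    by (rule lower_bound_by_reflections[OF T(1) r c])
qed


section \<open>Solutions of the reduced problem\<close>

lemma hdist_eq_axis_dist:
  "hdist n m M x r = axis_dist ((M + real n * m) / (m * real n)) x r"
  by (simp only: hdist_def axis_dist_def power_mult_distrib)

abbreviation reduced_field where
  "reduced_field n m M r0 a c \<equiv>
     axis_field ((M + real n * m) / (m * real n)) (M + m * real n) (m * lam n) M c (r0\<^sup>2 * a\<^sup>2)"

lemma reduced_solution_imp_field:
  assumes sol: "reduced_solution n m M r0 a f r" and "c \<le> r t"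
  shows "((\<lambda>t. (f t, deriv f t, r t, deriv r t)) has_vector_derivative
     reduced_field n m M r0 a c (f t, deriv f t, r t, deriv r t)) (at t)"
proof -
  have [simp]: "max c (r t) = r t" using \<open>c \<le> r t\<close> by simp
  have "(f has_real_derivative deriv f t) (at t)" "(r has_real_derivative deriv r t) (at t)"
    using sol unfolding reduced_solution_def by (auto simp: DERIV_deriv_iff_field_differentiable)
  then show ?thesis
    using sol unfolding reduced_solution_def axis_field_def Let_def prod.case hdist_eq_axis_dist
    by (intro has_vector_derivative_Pair)
       (auto simp: has_real_derivative_iff_has_vector_derivative[symmetric])
qed

lemma field_imp_reduced_solution:
  fixes z :: "real \<Rightarrow> real \<times> real \<times> real \<times> real"
  assumes z: "\<And>t. (z has_vector_derivative reduced_field n m M r0 a c (z t)) (at t)"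
    and c: "0 < c" "\<And>t. c \<le> fst (snd (snd (z t)))"
  shows "reduced_solution n m M r0 a (\<lambda>t. fst (z t)) (\<lambda>t. fst (snd (snd (z t))))"
    and "deriv (\<lambda>t. fst (z t)) = (\<lambda>t. fst (snd (z t)))"
    and "deriv (\<lambda>t. fst (snd (snd (z t)))) = (\<lambda>t. snd (snd (snd (z t))))"
proof -
  note fst = bounded_linear.has_vector_derivative[OF bounded_linear_fst]
    and snd = bounded_linear.has_vector_derivative[OF bounded_linear_snd]
  note comp = fst[OF z] fst[OF snd[OF z]] fst[OF snd[OF snd[OF z]]] snd[OF snd[OF snd[OF z]]]
  have max: "max c (fst (snd (snd (z t)))) = fst (snd (snd (z t)))" for t
    using c(2)[of t] by simp
  have D: "((\<lambda>t. fst (z t)) has_real_derivative fst (snd (z t))) (at t)"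
    "((\<lambda>t. fst (snd (snd (z t)))) has_real_derivative snd (snd (snd (z t)))) (at t)"
    "((\<lambda>t. fst (snd (z t))) has_real_derivative
       - ((M + m * real n) * fst (z t)) / hdist n m M (fst (z t)) (fst (snd (snd (z t)))) ^ 3) (at t)"
    "((\<lambda>t. snd (snd (snd (z t)))) has_real_derivative
       r0\<^sup>2 * a\<^sup>2 / fst (snd (snd (z t))) ^ 3 - m * lam n / (fst (snd (snd (z t))))\<^sup>2
         - M * fst (snd (snd (z t))) / hdist n m M (fst (z t)) (fst (snd (snd (z t)))) ^ 3) (at t)" for t
    using comp[of t] max[of t]
    by (auto simp: has_real_derivative_iff_has_vector_derivative axis_field_def Let_def
          case_prod_unfold hdist_eq_axis_dist)
  show d: "deriv (\<lambda>t. fst (z t)) = (\<lambda>t. fst (snd (z t)))"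
    "deriv (\<lambda>t. fst (snd (snd (z t)))) = (\<lambda>t. snd (snd (snd (z t))))"
    using D by (auto intro!: ext DERIV_imp_deriv)
  show "reduced_solution n m M r0 a (\<lambda>t. fst (z t)) (\<lambda>t. fst (snd (snd (z t))))"
    unfolding reduced_solution_def d
    using D less_le_trans[OF c] by (auto simp: field_differentiable_def)
qed

text \<open>On a compact time interval both radii stay above some \<open>c > 0\<close>, and there both solutions follow
  the same globally Lipschitz field.\<close>
lemma ivp_solution_unique:
  assumes pos: "n > 0" "m > 0" "M \<ge> 0" "lam n > 0"
    and sol: "ivp_solution n m M r0 a b f r" "ivp_solution n m M r0 a b g s"
  shows "g = f \<and> s = r"
proof -
  have "g t = f t \<and> s t = r t" for t
  proof -
    have "\<exists>c>0. \<forall>\<tau>\<in>{-\<bar>t\<bar>..\<bar>t\<bar>}. c \<le> y \<tau>" if "ivp_solution n m M r0 a b x y" for x y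
    proof -
      have y: "\<And>\<tau>. 0 < y \<tau>" "continuous_on {-\<bar>t\<bar>..\<bar>t\<bar>} y"
        using that unfolding ivp_solution_def reduced_solution_def
        by (auto intro!: continuous_at_imp_continuous_on field_differentiable_imp_continuous_at)
      obtain \<tau>0 where "\<forall>\<tau>\<in>{-\<bar>t\<bar>..\<bar>t\<bar>}. y \<tau>0 \<le> y \<tau>"
        using continuous_attains_inf[OF _ _ y(2)] by auto
      then show ?thesis using y(1) by blast
    qed
    from this[OF sol(1)] this[OF sol(2)] obtain c1 c2 where c:
      "c1 > 0" "\<forall>\<tau>\<in>{-\<bar>t\<bar>..\<bar>t\<bar>}. c1 \<le> r \<tau>" "c2 > 0" "\<forall>\<tau>\<in>{-\<bar>t\<bar>..\<bar>t\<bar>}. c2 \<le> s \<tau>"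
      by blast
    define c where "c = min c1 c2"
    have "c > 0" using c by (simp add: c_def)
    have "(M + real n * m) / (m * real n) > 0" "M + m * real n > 0" "m * lam n > 0"
      using pos by (auto intro!: divide_pos_pos add_nonneg_pos)
    then obtain L where L: "L-lipschitz_on UNIV (reduced_field n m M r0 a c)"
      using axis_field_ex_lipschitz \<open>M \<ge> 0\<close> \<open>c > 0\<close> by blast
    have "(g t, deriv g t, s t, deriv s t) = (f t, deriv f t, r t, deriv r t)"
    proof (rule lipschitz_ode_unique[OF L, where x = "\<lambda>t. (g t, deriv g t, s t, deriv s t)"
          and y = "\<lambda>t. (f t, deriv f t, r t, deriv r t)" and a = "-\<bar>t\<bar>" and b = "\<bar>t\<bar>" and ?t0.0 = 0])
      fix \<tau> assume \<tau>: "-\<bar>t\<bar> \<le> \<tau>" "\<tau> \<le> \<bar>t\<bar>"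
      show "(f \<tau>, deriv f \<tau>, r \<tau>, deriv r \<tau>) \<in> UNIV \<and> ((\<lambda>t. (f t, deriv f t, r t, deriv r t))
          has_vector_derivative reduced_field n m M r0 a c (f \<tau>, deriv f \<tau>, r \<tau>, deriv r \<tau>)) (at \<tau>)"
        using sol(1) c \<tau> by (auto intro!: reduced_solution_imp_field simp: ivp_solution_def c_def min_le_iff_disj)
      show "(g \<tau>, deriv g \<tau>, s \<tau>, deriv s \<tau>) \<in> UNIV \<and> ((\<lambda>t. (g t, deriv g t, s t, deriv s t))
          has_vector_derivative reduced_field n m M r0 a c (g \<tau>, deriv g \<tau>, s \<tau>, deriv s \<tau>)) (at \<tau>)"
        using sol(2) c \<tau> by (auto intro!: reduced_solution_imp_field simp: ivp_solution_def c_def min_le_iff_disj)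
    qed (use sol in \<open>auto simp: ivp_solution_def\<close>)
    then show ?thesis by simp
  qed
  then show ?thesis by blast
qed


lemma lam_pos:
  assumes "n \<ge> 2" shows "lam n > 0"
proof -
  have "0 < 1 / sin (real k * pi / real n)" if "k \<in> {1..n - 1}" for k
  proof -
    have "real k < real n" using that assms by auto
    then have "real k * pi / real n < pi" using assms by (simp add: field_simps)
    moreover have "0 < real k * pi / real n" using that assms by simp
    ultimately show ?thesis using sin_gt_zero by simp
  qed
  then show ?thesis
    using assms unfolding lam_def by (intro mult_pos_pos sum_pos) auto
qed

theorem theorem3p2:
  fixes n :: nat and m M :: real
  assumes "n \<ge> 2" and "m > 0" and "M \<ge> 0"
    and "\<And>q::nat. q > 0 \<Longrightarrow> even q \<Longrightarrow>
           lam n \<noteq> real n * (real q)^2 + (M / m) * ((real q)^2 - 1)"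
  shows "\<forall>r0>0. \<forall>\<epsilon>>0. \<exists>a b T :: real.
           a > 0 \<and> T > 0 \<and> 0 < \<bar>b\<bar> \<and> \<bar>b\<bar> < \<epsilon> \<and>
           \<bar>T - pi / 2 * sqrt (r0^3 / (real n * m + M))\<bar> < \<epsilon> \<and>
           \<bar>a - sqrt ((lam n * m + M) / r0)\<bar> < \<epsilon> \<and>
           (\<exists>f r. odd_even_periodic_solution n m M r0 a b T f r \<and>
                  (\<forall>g s. ivp_solution n m M r0 a b g s \<longrightarrow> g = f \<and> s = r))"
proof (intro allI impI)
  fix r0 e :: real
  assume "r0 > 0" "e > 0"
  have lam: "lam n > 0" using lam_pos[OF assms(1)] .
  have n: "real n > 0" "n > 0" using assms(1) by auto
  have mn: "(M + real n * m) / (m * real n) > 0" "M + m * real n > 0" "m * lam n > 0"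
    using n assms(2,3) lam by (auto intro!: divide_pos_pos add_nonneg_pos)
  interpret near_circular "(M + real n * m) / (m * real n)" "M + m * real n" "m * lam n" M r0
    using mn assms(3) \<open>r0 > 0\<close> by unfold_locales
  have nonres: "sin (\<nu> * (pi / (2 * \<omega>))) \<noteq> 0"
  proof
    assume "sin (\<nu> * (pi / (2 * \<omega>))) = 0"
    then obtain i :: int where i: "\<nu> * (pi / (2 * \<omega>)) = of_int i * pi"
      by (auto simp: sin_zero_iff_int2)
    then have \<nu>: "\<nu> = 2 * of_int i * \<omega>"
      using frequencies_pos by (simp add: field_simps)
    then have "i > 0"
      using frequencies_pos by (simp add: zero_less_mult_iff)
    \<comment> \<open>A resonance means \<open>\<nu> = q \<omega>\<close> for the even number \<open>q = 2 i\<close>, which is the excluded equation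
      after squaring.\<close>
    define q where "q = 2 * nat i"
    have q: "q > 0" "even q" "real q = 2 * of_int i"
      using \<open>i > 0\<close> by (auto simp: q_def)
    have "\<nu>\<^sup>2 = (real q)\<^sup>2 * \<omega>\<^sup>2" by (simp add: \<nu> q(3) power_mult_distrib)
    then have "m * lam n + M = (real q)\<^sup>2 * (M + m * real n)"
      using \<open>r0 > 0\<close> by (simp add: frequencies_sq)
    then have "lam n = real n * (real q)\<^sup>2 + (M / m) * ((real q)\<^sup>2 - 1)"
      using assms(2) by (simp add: field_simps)
    then show False using assms(4)[OF q(1,2)] by simp
  qed
  define a0 where "a0 = sqrt ((lam n * m + M) / r0)"
  have a0: "a0 > 0" "a0\<^sup>2 = (lam n * m + M) / r0"
    using mn assms(3) \<open>r0 > 0\<close> by (auto simp: a0_def mult.commute add_pos_nonneg)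
  \<comment> \<open>\<open>\<epsilon> < a0\<^sup>2\<close> keeps \<open>a\<^sup>2\<close> positive, and \<open>\<epsilon> < e a0\<close> gives \<open>|a - a0| \<le> \<epsilon> / a0 < e\<close>.\<close>
  define \<delta> where "\<delta> = min e (min (a0\<^sup>2) (e * a0))"
  have "\<delta> > 0" using a0(1) \<open>e > 0\<close> by (simp add: \<delta>_def)
  from quarter_period_orbit[OF nonres this] obtain \<epsilon> \<alpha> T z where
    \<epsilon>: "0 < \<epsilon>" "\<epsilon> < \<delta>" and \<alpha>: "\<bar>\<alpha>\<bar> \<le> 1" and T: "0 < T" "\<bar>T - pi / (2 * \<omega>)\<bar> < \<delta>"
    and z0: "z 0 = (0, \<epsilon>, r0, 0)"
    and z: "\<And>t. (z has_vector_derivative field (ang \<epsilon> \<alpha>) (z t)) (at t)"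
    and zT: "fst (snd (z T)) = 0" "snd (snd (snd (z T))) = 0"
    and bound: "\<And>t. t \<in> {0..T} \<Longrightarrow> r0 / 2 \<le> fst (snd (snd (z t)))"
    by blast
  define a where "a = sqrt (a0\<^sup>2 + \<epsilon> * \<alpha>)"
  have \<epsilon>\<alpha>: "\<bar>\<epsilon> * \<alpha>\<bar> \<le> \<epsilon>"
    using \<alpha> \<epsilon>(1) mult_left_mono[OF \<alpha>, of \<epsilon>] by (simp add: abs_mult)
  have "a0\<^sup>2 + \<epsilon> * \<alpha> > 0"
    using \<epsilon>\<alpha> \<epsilon>(2) by (auto simp: \<delta>_def)
  then have a: "a > 0" "a\<^sup>2 = a0\<^sup>2 + \<epsilon> * \<alpha>" by (auto simp: a_def)
  have "ang \<epsilon> \<alpha> = r0\<^sup>2 * a\<^sup>2"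
    using \<open>r0 > 0\<close> unfolding a(2) a0(2)
    by (simp add: ang_def field_simps power2_eq_square)
  note z = z[unfolded this]
  have "\<bar>a - a0\<bar> < e"
  proof -
    have "\<bar>a - a0\<bar> * a0 \<le> \<bar>a - a0\<bar> * (a + a0)"
      using a a0 by (intro mult_left_mono) auto
    also have "\<dots> = \<bar>(a - a0) * (a + a0)\<bar>"
      using a(1) a0(1) by (simp add: abs_mult)
    also have "(a - a0) * (a + a0) = \<epsilon> * \<alpha>"
      using a(2) by (simp add: power2_eq_square algebra_simps)
    also have "\<bar>\<epsilon> * \<alpha>\<bar> < e * a0"
      using \<epsilon>\<alpha> \<epsilon>(2) by (simp add: \<delta>_def)
    finally show ?thesis using a0(1) by simp
  qed
  moreover have "pi / (2 * \<omega>) = pi / 2 * sqrt (r0^3 / (real n * m + M))"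
    using frequencies_pos by (simp add: \<omega>_def real_sqrt_divide field_simps)
  ultimately have near: "\<bar>T - pi / 2 * sqrt (r0^3 / (real n * m + M))\<bar> < e"
    "\<bar>a - sqrt ((lam n * m + M) / r0)\<bar> < e" "\<bar>\<epsilon>\<bar> < e"
    using T \<epsilon> by (auto simp: \<delta>_def a0_def)
  have c: "r0 / 2 > 0" using \<open>r0 > 0\<close> by simp
  obtain L where L: "L-lipschitz_on UNIV (field (r0\<^sup>2 * a\<^sup>2))"
    using axis_field_ex_lipschitz[OF mn assms(3) c] by blast
  have z00: "fst (z 0) = 0" "snd (snd (snd (z 0))) = 0" by (simp_all add: z0)
  note per = reflected_quarter_orbit_periodic[OF L z z00 T(1) zT bound]
  note sol = field_imp_reduced_solution[OF z c per(3)]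
  define f r where "f = (\<lambda>t. fst (z t))" and "r = (\<lambda>t. fst (snd (snd (z t))))"
  have "odd_even_periodic_solution n m M r0 a \<epsilon> T f r"
    using sol per(1,2) T(1) zT z0 unfolding f_def r_def
    by (auto simp: odd_even_periodic_solution_def ivp_solution_def)
  moreover from this have "ivp_solution n m M r0 a \<epsilon> g s \<longrightarrow> g = f \<and> s = r" for g s
    using ivp_solution_unique[OF n(2) assms(2,3) lam] by (auto simp: odd_even_periodic_solution_def)
  ultimately show "\<exists>a b T. a > 0 \<and> T > 0 \<and> 0 < \<bar>b\<bar> \<and> \<bar>b\<bar> < e \<and>
           \<bar>T - pi / 2 * sqrt (r0^3 / (real n * m + M))\<bar> < e \<and>
           \<bar>a - sqrt ((lam n * m + M) / r0)\<bar> < e \<and>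
           (\<exists>f r. odd_even_periodic_solution n m M r0 a b T f r \<and>
                  (\<forall>g s. ivp_solution n m M r0 a b g s \<longrightarrow> g = f \<and> s = r))"
    using a(1) T(1) \<epsilon>(1) near
    by (intro exI[of _ a] exI[of _ \<epsilon>] exI[of _ T] conjI) auto
qed

end
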